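(* Let $A\ge 0$, $B>0$, $\alpha>0$ be real numbers, let $\mathbb{D}=\{z\in\mathbb{C}:|z|<1\}$, and let $$\phi(z)=(1-|z|^2)^A\exp\left(\frac{-B}{(1-|z|^2)^{\alpha}}\right),\qquad z\in\mathbb{D}.$$ Let $$\Omega=\{(z_1,z_2)\in\mathbb{C}^2 : z_1\in\mathbb{D},\ |z_2|<\phi(z_1)\}.$$ Let $\mathbf{S}_{\Omega}$ be the Szegő projection operator of $\Omega$ associated to the Euclidean surface measure $d\sigma_E$ on the topological boundary $b\Omega$, and let $p\in(1,\infty)$. Then $\mathbf{S}_{\Omega}$ is bounded on $L^p(b\Omega)$ if and only if $p=2$.
   Context: $b\Omega$ denotes the topological boundary of $\Omega$ in $\mathbb{C}^2$, and $d\sigma_E$ denotes the Euclidean surface measure on $b\Omega$. Explicitly, for the domain $\Omega$ in the claim, $$\int_{b\Omega}\Phi\,d\sigma_E=\int_{\mathbb{D}}\int_0^{2\pi}\Phi\left(z_1,e^{i\theta}\phi(z_1)\right)\phi(z_1)\sqrt{1+|\nabla\phi(z_1)|^2}\,d\theta\,dA(z_1),$$ where $dA$ is Lebesgue area measure on $\mathbb{D}$ and $\nabla\phi$ is the real gradient of $\phi$ as a function on $\mathbb{D}\subset\mathbb{R}^2$. (The rest of the boundary, the circle $\{|z_1|=1,\ z_2=0\}$, has measure zero.) $L^p(b\Omega)$ is the Lebesgue space of complex-valued functions on $b\Omega$ with respect to $d\sigma_E$. For $1\le p<\infty$, the Hardy space $H^p(b\Omega)$ is the closure in $L^p(b\Omega)$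 of the set of (boundary values of) functions that are holomorphic on $\Omega$ and continuous up to the boundary, i.e. on $\overline{\Omega}$. The Szegő projection $\mathbf{S}_{\Omega}:L^2(b\Omega)\to H^2(b\Omega)$ is the orthogonal projection of $L^2(b\Omega)$ onto the closed subspace $H^2(b\Omega)$. "$\mathbf{S}_{\Omega}$ is bounded on $L^p(b\Omega)$" means that there is a constant $C>0$ such that $\|\mathbf{S}_{\Omega}f\|_{L^p(b\Omega)}\le C\|f\|_{L^p(b\Omega)}$ for all $f\in L^2(b\Omega)\cap L^p(b\Omega)$. *)

theory Defs
  imports "HOL-Analysis.Analysis"
begin

section \<open>\<open>L\<^sup>p\<close> spaces, represented by functions\<close>

text \<open>Two members that agree almost everywhere represent the same element; there is no quotient.\<close>

definition Lp_space :: "real \<Rightarrow> 'a measure \<Rightarrow> ('a \<Rightarrow> complex) set" where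
  "Lp_space p M = {f \<in> borel_measurable M. integrable M (\<lambda>x. norm (f x) powr p)}"

definition Lp_norm :: "real \<Rightarrow> 'a measure \<Rightarrow> ('a \<Rightarrow> complex) \<Rightarrow> real" where
  "Lp_norm p M f = (\<integral>x. norm (f x) powr p \<partial>M) powr (1 / p)"

definition L2_inner :: "'a measure \<Rightarrow> ('a \<Rightarrow> complex) \<Rightarrow> ('a \<Rightarrow> complex) \<Rightarrow> complex" where
  "L2_inner M f g = (\<integral>x. f x * cnj (g x) \<partial>M)"

definition Lp_closure :: "real \<Rightarrow> 'a measure \<Rightarrow> ('a \<Rightarrow> complex) set \<Rightarrow> ('a \<Rightarrow> complex) set" where
  "Lp_closure p M F =
     {f \<in> Lp_space p M. \<forall>e>0. \<exists>g \<in> F \<inter> Lp_space p M. Lp_norm p M (\<lambda>x. f x - g x) < e}"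

text \<open>The value at \<open>f\<close> is a representative of the projection; it is determined up to a null set
  when \<open>f\<close> is in \<open>L\<^sup>2\<close> and \<open>H\<close> is a closed subspace, and unspecified when \<open>f\<close> has no projection.\<close>

definition orthogonal_projection ::
  "'a measure \<Rightarrow> ('a \<Rightarrow> complex) set \<Rightarrow> ('a \<Rightarrow> complex) \<Rightarrow> ('a \<Rightarrow> complex)" where
  "orthogonal_projection M H f =
     (SOME g. g \<in> H \<and> (\<forall>h\<in>H. L2_inner M (\<lambda>x. f x - g x) h = 0))"

text \<open>\<open>Lp_norm\<close> is only meaningful on \<open>Lp_space\<close>, so membership of \<open>T f\<close> is part of boundedness.\<close>

definition bounded_on_Lp ::
  "real \<Rightarrow> 'a measure \<Rightarrow> (('a \<Rightarrow> complex) \<Rightarrow> ('a \<Rightarrow> complex)) \<Rightarrow> bool" where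
  "bounded_on_Lp p M T \<longleftrightarrow>
     (\<exists>C>0. \<forall>f \<in> Lp_space 2 M \<inter> Lp_space p M.
        T f \<in> Lp_space p M \<and> Lp_norm p M (T f) \<le> C * Lp_norm p M f)"


section \<open>Hardy spaces and the Szego projection on domains in \<open>\<complex>\<^sup>2\<close>\<close>

text \<open>The real derivative exists and is complex linear.\<close>

definition holomorphic_on_C2 :: "(complex \<times> complex \<Rightarrow> complex) \<Rightarrow> (complex \<times> complex) set \<Rightarrow> bool" where
  "holomorphic_on_C2 f S \<longleftrightarrow>
     (\<forall>z\<in>S. \<exists>a b. (f has_derivative (\<lambda>h. a * fst h + b * snd h)) (at z))"

text \<open>Below, \<open>M\<close> is a measure with underlying space \<open>frontier S\<close>, so that only the boundary values
  of a function matter for membership in \<open>Lp_space p M\<close>.\<close>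

definition Hardy_space ::
  "real \<Rightarrow> (complex \<times> complex) set \<Rightarrow> (complex \<times> complex) measure \<Rightarrow> (complex \<times> complex \<Rightarrow> complex) set" where
  "Hardy_space p S M = Lp_closure p M {g. holomorphic_on_C2 g S \<and> continuous_on (closure S) g}"

definition Szego_projection ::
  "(complex \<times> complex) set \<Rightarrow> (complex \<times> complex) measure \<Rightarrow>
     (complex \<times> complex \<Rightarrow> complex) \<Rightarrow> (complex \<times> complex \<Rightarrow> complex)" where
  "Szego_projection S M = orthogonal_projection M (Hardy_space 2 S M)"


section \<open>Hartogs domains over the unit disc and their surface measure\<close>

definition Hartogs_domain :: "(complex \<Rightarrow> real) \<Rightarrow> (complex \<times> complex) set" where
  "Hartogs_domain \<phi> = {(z1, z2). z1 \<in> ball 0 1 \<and> norm z2 < \<phi> z1}"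

definition gradient :: "(complex \<Rightarrow> real) \<Rightarrow> complex \<Rightarrow> complex" where
  "gradient \<phi> z = (THE D. GDERIV \<phi> z :> D)"

text \<open>The Euclidean surface measure of the part of the boundary lying over the open disc, computed
  in the parametrization \<open>(z, \<theta>) \<mapsto> (z, e\<^sup>i\<^sup>\<theta> \<phi>(z))\<close> whose area element is
  \<open>\<phi>(z) sqrt (1 + |\<nabla>\<phi>(z)|\<^sup>2) dA(z) d\<theta>\<close>. If \<open>\<phi>\<close> tends to \<open>0\<close> at the unit circle, the remaining
  boundary points form a circle, which is a null set.\<close>

definition surface_measure :: "(complex \<Rightarrow> real) \<Rightarrow> (complex \<times> complex) measure" where
  "surface_measure \<phi> =
     distr
       (density
         (restrict_space lborel (ball 0 1) \<Otimes>\<^sub>M restrict_space lborel {0..2*pi})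
         (\<lambda>(z, \<theta>). ennreal (\<phi> z * sqrt (1 + (norm (gradient \<phi> z))\<^sup>2))))
       (restrict_space borel (frontier (Hartogs_domain \<phi>)))
       (\<lambda>(z, \<theta>). (z, cis \<theta> * complex_of_real (\<phi> z)))"

text \<open>The argument \<open>z\<close> is only used in the unit disc.\<close>

definition exp_profile :: "real \<Rightarrow> real \<Rightarrow> real \<Rightarrow> complex \<Rightarrow> real" where
  "exp_profile A B \<alpha> z =
     (1 - (norm z)\<^sup>2) powr A * exp (- B / (1 - (norm z)\<^sup>2) powr \<alpha>)"

end

theory Submission
  imports Defs "HOL-Complex_Analysis.Complex_Analysis" "HOL-Real_Asymp.Real_Asymp"
begin

text \<open>
  For \<open>p = 2\<close> the statement holds on every domain: an orthogonal projection does not increase the norm.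
  The point to check is that the projection exists, that is, the projection theorem for the closure of
  a linear space of functions in \<open>L\<^sup>2\<close> (\<open>orthogonal_projection_exists\<close>, based on
  \<open>Riesz_Fischer_geometric\<close>).

  For \<open>p \<noteq> 2\<close> it is enough to look at functions of \<open>z\<^sub>1\<close> alone. On these the projection acts as the Bergman
  projection of the disc for a radial weight, comparable to \<open>\<phi>\<close>. By rotational symmetry a function
  \<open>u\<close> with \<open>u(c z) = c\<^sup>n u(z)\<close> for all unimodular \<open>c\<close> is projected to a multiple of \<open>z\<^sup>n\<close>
  (\<open>fst_L2_inner_holomorphic_eq_0\<close>, \<open>Szego_fst_AE_eq\<close>). Let \<open>m(s)\<close> be the weighted integral of \<open>\<bar>z\<bar>\<^sup>s\<close> and \<open>q\<close>
  the exponent dual to \<open>p\<close>. Choosing for \<open>u\<close> the extremal function in Hoelder's inequality shows that a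
  bounded projection yields
    \<open>m(np)\<^bsup>1/p\<^esup> m(nq)\<^bsup>1/q\<^esup> \<le> C m(2n)\<close> for all \<open>n \<ge> 1\<close>
  (\<open>Szego_bounded_imp_moment_inequality\<close>).

  The exponential decay of the profile gives \<open>- ln m(s) \<sim> c s\<^sup>\<beta>\<close> with \<open>\<beta> = \<alpha> / (1 + \<alpha>)\<close> and some \<open>c > 0\<close>
  (\<open>moment_upper\<close>, \<open>moment_lower_asymp\<close>). The moment inequality then forces
    \<open>2\<^sup>\<beta> \<le> p\<^sup>\<beta> / p + q\<^sup>\<beta> / q\<close>,
  but \<open>0 < \<beta> < 1\<close> and \<open>(1/p) p + (1/q) q = 2\<close>, so strict concavity of \<open>x\<^sup>\<beta>\<close> rules this out unless \<open>p = q = 2\<close>.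
  For a polynomially decaying profile \<open>m(s)\<close> would decay like a power of \<open>s\<close> and both sides of the moment
  inequality would be comparable.
\<close>

section \<open>Orthogonal projections in \<open>L\<^sup>2\<close>\<close>

lemma Lp_space_2_iff:
  "f \<in> Lp_space 2 M \<longleftrightarrow> f \<in> borel_measurable M \<and> integrable M (\<lambda>x. (norm (f x))\<^sup>2)"
  by (simp add: Lp_space_def)

lemma Lp_norm_2: "(Lp_norm 2 M f)\<^sup>2 = (\<integral>x. (norm (f x))\<^sup>2 \<partial>M)"
proof -
  have "0 \<le> (\<integral>x. (norm (f x))\<^sup>2 \<partial>M)" by simp
  then show ?thesis by (simp add: Lp_norm_def powr_half_sqrt)
qed

lemma Lp_norm_nonneg: "0 \<le> Lp_norm p M f"
  by (simp add: Lp_norm_def)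

lemma L2_integrable: "f \<in> Lp_space 2 M \<Longrightarrow> integrable M (\<lambda>x. (norm (f x))\<^sup>2)"
  by (simp add: Lp_space_2_iff)

lemma L2_scale: "f \<in> Lp_space 2 M \<Longrightarrow> (\<lambda>x. c * f x) \<in> Lp_space 2 M"
  by (auto simp: Lp_space_2_iff norm_mult power_mult_distrib)

lemma L2_add:
  assumes "f \<in> Lp_space 2 M" "g \<in> Lp_space 2 M"
  shows "(\<lambda>x. f x + g x) \<in> Lp_space 2 M"
proof -
  have [measurable]: "f \<in> borel_measurable M" "g \<in> borel_measurable M"
    using assms by (auto simp: Lp_space_2_iff)
  have "(norm (a + b))\<^sup>2 \<le> 2 * (norm a)\<^sup>2 + 2 * (norm b)\<^sup>2" for a b :: complex
  proof -
    have "(norm (a + b))\<^sup>2 \<le> (norm a + norm b)\<^sup>2"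
      by (simp add: norm_triangle_ineq power_mono)
    also have "\<dots> \<le> 2 * (norm a)\<^sup>2 + 2 * (norm b)\<^sup>2"
      using sum_squares_bound[of "norm a" "norm b"] by (simp add: power2_sum)
    finally show ?thesis .
  qed
  note le = this
  have "integrable M (\<lambda>x. (norm (f x + g x))\<^sup>2)"
  proof (rule Bochner_Integration.integrable_bound)
    show "integrable M (\<lambda>x. 2 * (norm (f x))\<^sup>2 + 2 * (norm (g x))\<^sup>2)"
      using assms by (simp add: Lp_space_2_iff)
    show "AE x in M. norm ((norm (f x + g x))\<^sup>2) \<le> norm (2 * (norm (f x))\<^sup>2 + 2 * (norm (g x))\<^sup>2)"
      using le by simp
  qed measurable
  then show ?thesis by (simp add: Lp_space_2_iff)
qed

lemma L2_diff:
  assumes "f \<in> Lp_space 2 M" "g \<in> Lp_space 2 M"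
  shows "(\<lambda>x. f x - g x) \<in> Lp_space 2 M"
  using L2_add[OF assms(1) L2_scale[OF assms(2), of "-1"]] by simp

lemma mult_cnj_young:
  fixes a b :: complex
  assumes "t > 0"
  shows "norm (a * cnj b) \<le> (t * (norm a)\<^sup>2 + (norm b)\<^sup>2 / t) / 2"
proof -
  have "0 \<le> (t * norm a - norm b)\<^sup>2 / t" using assms by simp
  also have "\<dots> = t * (norm a)\<^sup>2 + (norm b)\<^sup>2 / t - 2 * (norm a * norm b)"
    using assms by (simp add: power2_eq_square field_simps)
  finally show ?thesis by (simp add: norm_mult)
qed

lemma borel_measurable_cnj [measurable (raw)]:
  "f \<in> borel_measurable M \<Longrightarrow> (\<lambda>x. cnj (f x)) \<in> borel_measurable M"
  by (rule measurable_compose[of f M borel cnj borel]) (auto intro: borel_measurable_continuous_onI continuous_intros)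

lemma L2_inner_integrable:
  assumes "f \<in> Lp_space 2 M" "g \<in> Lp_space 2 M"
  shows "integrable M (\<lambda>x. f x * cnj (g x))"
proof (rule Bochner_Integration.integrable_bound)
  show "integrable M (\<lambda>x. (1 * (norm (f x))\<^sup>2 + (norm (g x))\<^sup>2 / 1) / 2)"
    using assms by (auto simp: Lp_space_2_iff)
  show "(\<lambda>x. f x * cnj (g x)) \<in> borel_measurable M"
    using assms by (auto simp: Lp_space_2_iff)
  show "AE x in M. norm (f x * cnj (g x)) \<le> norm ((1 * (norm (f x))\<^sup>2 + (norm (g x))\<^sup>2 / 1) / 2)"
    by (rule AE_I2, rule order_trans[OF mult_cnj_young[of 1]]) auto
qed

text \<open>Young's inequality with a free weight \<open>t\<close> takes the place of Cauchy--Schwarz: a small second factor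
  forces a small inner product once \<open>t\<close> is chosen of the size of its norm.\<close>

lemma L2_inner_young:
  assumes "f \<in> Lp_space 2 M" "g \<in> Lp_space 2 M" "t > 0"
  shows "norm (L2_inner M f g) \<le> (t * (\<integral>x. (norm (f x))\<^sup>2 \<partial>M) + (\<integral>x. (norm (g x))\<^sup>2 \<partial>M) / t) / 2"
proof -
  have "norm (L2_inner M f g) \<le> (\<integral>x. norm (f x * cnj (g x)) \<partial>M)"
    unfolding L2_inner_def by (rule integral_norm_bound)
  also have "\<dots> \<le> (\<integral>x. (t * (norm (f x))\<^sup>2 + (norm (g x))\<^sup>2 / t) / 2 \<partial>M)"
    by (rule integral_mono)
       (use assms L2_inner_integrable[OF assms(1,2)] mult_cnj_young[OF \<open>t > 0\<close>]
        in \<open>auto simp: L2_integrable\<close>)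
  also have "\<dots> = (t * (\<integral>x. (norm (f x))\<^sup>2 \<partial>M) + (\<integral>x. (norm (g x))\<^sup>2 \<partial>M) / t) / 2"
    using assms by (simp add: L2_integrable)
  finally show ?thesis .
qed

lemma L2_inner_add_left:
  assumes "f \<in> Lp_space 2 M" "g \<in> Lp_space 2 M" "h \<in> Lp_space 2 M"
  shows "L2_inner M (\<lambda>x. f x + g x) h = L2_inner M f h + L2_inner M g h"
  using assms by (simp add: L2_inner_def distrib_right L2_inner_integrable)

lemma L2_inner_diff_left:
  assumes "f \<in> Lp_space 2 M" "g \<in> Lp_space 2 M" "h \<in> Lp_space 2 M"
  shows "L2_inner M (\<lambda>x. f x - g x) h = L2_inner M f h - L2_inner M g h"
  using assms by (simp add: L2_inner_def left_diff_distrib L2_inner_integrable)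

lemma L2_inner_diff_right:
  assumes "f \<in> Lp_space 2 M" "g \<in> Lp_space 2 M" "h \<in> Lp_space 2 M"
  shows "L2_inner M f (\<lambda>x. g x - h x) = L2_inner M f g - L2_inner M f h"
  using assms by (simp add: L2_inner_def right_diff_distrib L2_inner_integrable)

lemma L2_inner_self: "L2_inner M f f = of_real (\<integral>x. (norm (f x))\<^sup>2 \<partial>M)"
  unfolding L2_inner_def by (simp flip: complex_norm_square of_real_power)

lemma norm_diff_scaled_sq:
  fixes a b s :: complex
  shows "(norm (a - s * b))\<^sup>2
    = (norm a)\<^sup>2 - 2 * Re (cnj s * (a * cnj b)) + (norm s)\<^sup>2 * (norm b)\<^sup>2"
  by (simp only: cmod_power2) (simp add: power2_eq_square algebra_simps)

lemma L2_norm_diff_scaled: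
  assumes "f \<in> Lp_space 2 M" "g \<in> Lp_space 2 M"
  shows "(\<integral>x. (norm (f x - s * g x))\<^sup>2 \<partial>M)
    = (\<integral>x. (norm (f x))\<^sup>2 \<partial>M) - 2 * Re (cnj s * L2_inner M f g)
      + (norm s)\<^sup>2 * (\<integral>x. (norm (g x))\<^sup>2 \<partial>M)"
proof -
  have *: "integrable M (\<lambda>x. cnj s * (f x * cnj (g x)))"
    using L2_inner_integrable[OF assms] by simp
  define c where "c x = Re (cnj s * (f x * cnj (g x)))" for x
  have c: "integrable M c" unfolding c_def by (rule integrable_Re[OF *])
  have "(\<integral>x. (norm (f x - s * g x))\<^sup>2 \<partial>M)
    = (\<integral>x. (norm (f x))\<^sup>2 - 2 * c x + (norm s)\<^sup>2 * (norm (g x))\<^sup>2 \<partial>M)"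
    by (simp only: norm_diff_scaled_sq c_def)
  also have "\<dots> = (\<integral>x. (norm (f x))\<^sup>2 \<partial>M) - 2 * (\<integral>x. c x \<partial>M)
      + (norm s)\<^sup>2 * (\<integral>x. (norm (g x))\<^sup>2 \<partial>M)"
    using assms c by (simp add: L2_integrable)
  also have "(\<integral>x. c x \<partial>M) = Re (cnj s * L2_inner M f g)"
    unfolding c_def integral_Re[OF *] by (simp only: L2_inner_def integral_mult_right_zero)
  finally show ?thesis .
qed

text \<open>Geometric decay makes the increments summable almost everywhere, so no passage to a
  subsequence is needed in this form of the Riesz--Fischer theorem.\<close>

lemma Riesz_Fischer_geometric:
  fixes g :: "nat \<Rightarrow> 'a \<Rightarrow> complex"
  assumes g: "\<And>n. g n \<in> Lp_space 2 M"
    and fast: "\<And>n m. n \<le> m \<Longrightarrow> (\<integral>x. (norm (g n x - g m x))\<^sup>2 \<partial>M) \<le> K * (1/8) ^ n"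
  obtains l where "l \<in> Lp_space 2 M"
    and "\<And>n. (\<integral>x. (norm (g n x - l x))\<^sup>2 \<partial>M) \<le> K * (1/8) ^ n"
proof -
  have [measurable]: "g n \<in> borel_measurable M" for n
    using g by (simp add: Lp_space_2_iff)
  have K: "K \<ge> 0"
    using order_trans[OF integral_nonneg_AE fast[of 0 0]] by simp
  have nn: "(\<integral>\<^sup>+ x. ennreal ((norm (g n x - g m x))\<^sup>2) \<partial>M) \<le> ennreal (K * (1/8) ^ n)" if "n \<le> m" for n m
    by (subst nn_integral_eq_integral)
       (use L2_diff[OF g g] fast[OF that] in \<open>auto simp: L2_integrable intro: ennreal_leI\<close>)
  \<comment> \<open>The weights \<open>2 ^ n\<close> are still summable against \<open>(1/8) ^ n\<close>, and finiteness of the weighted sum at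
      \<open>x\<close> makes the increments at \<open>x\<close> decay geometrically.\<close>
  have "(\<integral>\<^sup>+ x. (\<Sum>n. ennreal (2 ^ n * (norm (g (Suc n) x - g n x))\<^sup>2)) \<partial>M)
      = (\<Sum>n. \<integral>\<^sup>+ x. ennreal (2 ^ n * (norm (g (Suc n) x - g n x))\<^sup>2) \<partial>M)"
    by (rule nn_integral_suminf) simp
  also have "\<dots> \<le> (\<Sum>n. ennreal (K * (1/4) ^ n))"
  proof (rule suminf_le)
    fix n
    have "(\<integral>\<^sup>+ x. ennreal (2 ^ n * (norm (g (Suc n) x - g n x))\<^sup>2) \<partial>M)
      = ennreal (2 ^ n) * (\<integral>\<^sup>+ x. ennreal ((norm (g n x - g (Suc n) x))\<^sup>2) \<partial>M)"
      by (simp add: ennreal_mult nn_integral_cmult norm_minus_commute)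
    also have "\<dots> \<le> ennreal (2 ^ n) * ennreal (K * (1/8) ^ n)"
      by (intro mult_left_mono nn) auto
    also have "\<dots> = ennreal (K * (1/4) ^ n)"
      using K by (simp add: ennreal_mult[symmetric] power_divide field_simps flip: power_mult_distrib)
    finally show "(\<integral>\<^sup>+ x. ennreal (2 ^ n * (norm (g (Suc n) x - g n x))\<^sup>2) \<partial>M) \<le> ennreal (K * (1/4) ^ n)" .
  qed auto
  also have "\<dots> = ennreal (\<Sum>n. K * (1/4) ^ n)"
    by (rule suminf_ennreal2) (use K in auto)
  also have "\<dots> < \<infinity>" by simp
  finally have fin: "(\<integral>\<^sup>+ x. (\<Sum>n. ennreal (2 ^ n * (norm (g (Suc n) x - g n x))\<^sup>2)) \<partial>M) < \<infinity>" .
  have "AE x in M. (\<Sum>n. ennreal (2 ^ n * (norm (g (Suc n) x - g n x))\<^sup>2)) \<noteq> \<infinity>"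
    by (rule nn_integral_noteq_infinite[OF _ less_imp_neq[OF fin]]) measurable
  moreover have "convergent (\<lambda>n. g n x)"
    if inc_fin: "(\<Sum>n. ennreal (2 ^ n * (norm (g (Suc n) x - g n x))\<^sup>2)) \<noteq> \<infinity>" for x
  proof -
    define a where "a n = 2 ^ n * (norm (g (Suc n) x - g n x))\<^sup>2" for n
    have a0: "0 \<le> a n" for n by (simp add: a_def)
    have "(\<Sum>n. ennreal (a n)) \<noteq> top" using inc_fin unfolding a_def infinity_ennreal_def .
    then have sa: "summable a" by (rule summable_suminf_not_top[OF a0])
    define S where "S = suminf a"
    have "norm (g (Suc n) x - g n x) \<le> sqrt S * sqrt (1/2) ^ n" for n
    proof -
      have "sum a {n} \<le> S"
        unfolding S_def by (rule sum_le_suminf[OF sa]) (auto simp: a0)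
      then have "(norm (g (Suc n) x - g n x))\<^sup>2 \<le> S * (1/2) ^ n"
        by (simp add: a_def field_simps power_divide)
      then have "norm (g (Suc n) x - g n x) \<le> sqrt (S * (1/2) ^ n)"
        by (rule real_le_rsqrt)
      then show ?thesis by (simp only: real_sqrt_mult real_sqrt_power)
    qed
    note inc = this
    have geo: "summable (\<lambda>n. sqrt S * sqrt (1/2) ^ n)"
      by (intro summable_mult summable_geometric) (simp add: real_sqrt_divide)
    have "summable (\<lambda>n. g (Suc n) x - g n x)"
      by (rule summable_comparison_test'[OF geo, of 0]) (rule inc)
    then have "convergent (\<lambda>n. g n x - g 0 x)"
      unfolding summable_iff_convergent sum_lessThan_telescope[of "\<lambda>n. g n x"] .
    from convergent_add[OF this convergent_const[of "g 0 x"]] show ?thesis by simp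
  qed
  ultimately have conv: "AE x in M. (\<lambda>n. g n x) \<longlonglongrightarrow> lim (\<lambda>n. g n x)"
    unfolding convergent_LIMSEQ_iff by (auto elim!: AE_mp)
  define l where "l x = lim (\<lambda>n. g n x)" for x
  have [measurable]: "l \<in> borel_measurable M"
    unfolding l_def by measurable
  have fatou: "(\<integral>\<^sup>+ x. ennreal ((norm (g n x - l x))\<^sup>2) \<partial>M) \<le> ennreal (K * (1/8) ^ n)" for n
  proof -
    have "AE x in M. ennreal ((norm (g n x - l x))\<^sup>2) = liminf (\<lambda>m. ennreal ((norm (g n x - g m x))\<^sup>2))"
      using conv
    proof eventually_elim
      case (elim x)
      then have "(\<lambda>m. ennreal ((norm (g n x - g m x))\<^sup>2)) \<longlonglongrightarrow> ennreal ((norm (g n x - l x))\<^sup>2)"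
        unfolding l_def by (intro tendsto_intros) auto
      from lim_imp_Liminf[OF sequentially_bot this] show ?case by (rule sym)
    qed
    then have "(\<integral>\<^sup>+ x. ennreal ((norm (g n x - l x))\<^sup>2) \<partial>M)
        = (\<integral>\<^sup>+ x. liminf (\<lambda>m. ennreal ((norm (g n x - g m x))\<^sup>2)) \<partial>M)"
      by (rule nn_integral_cong_AE)
    also have "\<dots> \<le> liminf (\<lambda>m. \<integral>\<^sup>+ x. ennreal ((norm (g n x - g m x))\<^sup>2) \<partial>M)"
      by (rule nn_integral_liminf) measurable
    also have "\<dots> \<le> liminf (\<lambda>m. ennreal (K * (1/8) ^ n))"
      by (rule Liminf_mono) (use nn in \<open>auto simp: eventually_sequentially\<close>)
    finally show ?thesis by (simp add: Liminf_const)
  qed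
  have int: "integrable M (\<lambda>x. (norm (g n x - l x))\<^sup>2)" for n
    using fatou[of n] by (intro integrableI_nonneg) (auto simp: ennreal_less_top intro: le_less_trans)
  have "(\<lambda>x. g 0 x - l x) \<in> Lp_space 2 M"
    using int[of 0] by (simp add: Lp_space_2_iff)
  then have "l \<in> Lp_space 2 M"
    using L2_diff[OF g[of 0]] by fastforce
  moreover have "(\<integral>x. (norm (g n x - l x))\<^sup>2 \<partial>M) \<le> K * (1/8) ^ n" for n
    using fatou[of n] K by (subst (asm) nn_integral_eq_integral[OF int]) auto
  ultimately show ?thesis using that by blast
qed

text \<open>An approximant \<open>g\<close> of \<open>h\<close> at distance below \<open>e\<close>, combined with the weight \<open>t = e\<close> in Young's
  inequality, bounds the inner product by a multiple of \<open>e\<close>.\<close>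

lemma orthogonal_to_closure:
  assumes u: "u \<in> Lp_space 2 M" and h: "h \<in> Lp_closure 2 M F"
    and orth: "\<And>g. g \<in> F \<inter> Lp_space 2 M \<Longrightarrow> L2_inner M u g = 0"
  shows "L2_inner M u h = 0"
proof -
  let ?U = "\<integral>x. (norm (u x))\<^sup>2 \<partial>M"
  have hL: "h \<in> Lp_space 2 M" using h by (simp add: Lp_closure_def)
  have "norm (L2_inner M u h) \<le> e * ((?U + 1) / 2)" if "e > 0" for e
  proof -
    obtain g where g: "g \<in> F \<inter> Lp_space 2 M" "Lp_norm 2 M (\<lambda>x. h x - g x) < e"
      using h \<open>e > 0\<close> by (auto simp: Lp_closure_def)
    have "(\<integral>x. (norm (h x - g x))\<^sup>2 \<partial>M) \<le> e\<^sup>2"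
      using g(2) Lp_norm_nonneg[of 2 M "\<lambda>x. h x - g x"] by (simp add: power_mono flip: Lp_norm_2)
    then have *: "(\<integral>x. (norm (h x - g x))\<^sup>2 \<partial>M) / e \<le> e"
      using \<open>e > 0\<close> by (simp add: field_simps power2_eq_square)
    have "L2_inner M u h = L2_inner M u (\<lambda>x. h x - g x)"
      using g(1) orth[OF g(1)] u hL by (simp add: L2_inner_diff_right)
    also have "norm \<dots> \<le> (e * ?U + (\<integral>x. (norm (h x - g x))\<^sup>2 \<partial>M) / e) / 2"
      by (rule L2_inner_young) (use u hL g \<open>e > 0\<close> in \<open>auto intro: L2_diff\<close>)
    also have "\<dots> \<le> e * ((?U + 1) / 2)" using * by (simp add: algebra_simps)
    finally show ?thesis .
  qed
  note bound = this
  have U: "?U \<ge> 0" by simp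
  have "norm (L2_inner M u h) \<le> 0 + e" if "e > 0" for e
    using bound[of "e / ((?U + 1) / 2)"] U that by (simp add: add_pos_nonneg)
  then have "norm (L2_inner M u h) \<le> 0" by (rule field_le_epsilon)
  then show ?thesis by simp
qed

text \<open>The usual minimising sequence, taken in \<open>F\<close> itself: its limit lies in the closure by
  definition, so it need not be shown that the closure is a subspace or is closed.\<close>

lemma orthogonal_projection_exists:
  assumes f: "f \<in> Lp_space 2 M"
    and zero: "(\<lambda>x. 0) \<in> F"
    and lin: "\<And>g h c. g \<in> F \<Longrightarrow> h \<in> F \<Longrightarrow> (\<lambda>x. g x + c * h x) \<in> F"
  shows "\<exists>g \<in> Lp_closure 2 M F. \<forall>h \<in> Lp_closure 2 M F. L2_inner M (\<lambda>x. f x - g x) h = 0"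
proof -
  define V where "V = F \<inter> Lp_space 2 M"
  define N where "N u = (\<integral>x. (norm (u x))\<^sup>2 \<partial>M)" for u :: "'a \<Rightarrow> complex"
  have VL: "h \<in> Lp_space 2 M" if "h \<in> V" for h using that by (simp add: V_def)
  have V_lin: "(\<lambda>x. g x + c * h x) \<in> V" if "g \<in> V" "h \<in> V" for g h c
    using that lin L2_add[OF _ L2_scale] by (auto simp: V_def)
  have V0: "(\<lambda>x. 0) \<in> V" using zero by (simp add: V_def Lp_space_2_iff)
  have N0: "N u \<ge> 0" for u by (simp add: N_def)
  define d where "d = (INF h\<in>V. N (\<lambda>x. f x - h x))"
  have bdd: "bdd_below ((\<lambda>h. N (\<lambda>x. f x - h x)) ` V)" by (rule bdd_belowI2[of _ 0]) (rule N0)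
  have d_le: "d \<le> N (\<lambda>x. f x - h x)" if "h \<in> V" for h
    unfolding d_def by (rule cINF_lower[OF bdd that])
  have "\<exists>h\<in>V. N (\<lambda>x. f x - h x) < d + (1/8)^n" for n :: nat
  proof -
    have "V \<noteq> {}" using V0 by blast
    moreover have "d < d + (1/8)^n" by simp
    ultimately show ?thesis unfolding d_def using cINF_less_iff[OF _ bdd] by blast
  qed
  then obtain g where gV: "g n \<in> V" and gd: "N (\<lambda>x. f x - g n x) < d + (1/8)^n" for n :: nat
    by metis
  \<comment> \<open>The parallelogram law: the midpoint of \<open>g n\<close> and \<open>g m\<close> is no closer to \<open>f\<close> than \<open>d\<close>.\<close>
  have fast: "N (\<lambda>x. g n x - g m x) \<le> 4 * (1/8)^n" if "n \<le> m" for n m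
  proof -
    define a where "a x = f x - g n x" for x
    define b where "b x = f x - g m x" for x
    have aL: "a \<in> Lp_space 2 M" and bL: "b \<in> Lp_space 2 M"
      unfolding a_def b_def using f VL[OF gV] by (auto intro: L2_diff)
    have mid: "(\<lambda>x. (1/2) * g n x + (1/2) * g m x) \<in> V"
      using V_lin[OF V_lin[OF V0 gV[of n], of "1/2"] gV[of m], of "1/2"] by simp
    have "N (\<lambda>x. a x - 1 * b x) = N a - 2 * Re (L2_inner M a b) + N b"
      unfolding N_def by (subst L2_norm_diff_scaled[OF aL bL]) simp
    moreover have "N (\<lambda>x. a x - (-1) * b x) = N a + 2 * Re (L2_inner M a b) + N b"
      unfolding N_def by (subst L2_norm_diff_scaled[OF aL bL]) simp
    moreover have "N (\<lambda>x. a x - (-1) * b x) = 4 * N (\<lambda>x. f x - ((1/2) * g n x + (1/2) * g m x))"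
    proof -
      have "(\<lambda>x. a x - (-1) * b x) = (\<lambda>x. 2 * (f x - ((1/2) * g n x + (1/2) * g m x)))"
        by (auto simp: a_def b_def algebra_simps)
      then show ?thesis by (simp add: N_def norm_mult power_mult_distrib del: right_diff_distrib_numeral)
    qed
    moreover have "(1/8::real)^m \<le> (1/8)^n" using that by (intro power_decreasing) auto
    ultimately have "N (\<lambda>x. a x - 1 * b x) \<le> 4 * (1/8)^n"
      using d_le[OF mid] gd[of n] gd[of m] unfolding a_def[symmetric] b_def[symmetric] by linarith
    moreover have "N (\<lambda>x. a x - 1 * b x) = N (\<lambda>x. g n x - g m x)"
      by (simp add: a_def b_def N_def norm_minus_commute)
    ultimately show ?thesis by simp
  qed
  obtain l where lL: "l \<in> Lp_space 2 M" and l: "\<And>n. N (\<lambda>x. g n x - l x) \<le> 4 * (1/8)^n"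
    using Riesz_Fischer_geometric[of g M 4] VL[OF gV] fast unfolding N_def by blast
  have l_cl: "l \<in> Lp_closure 2 M F"
    unfolding Lp_closure_def
  proof (intro CollectI conjI lL allI impI)
    fix e :: real assume "e > 0"
    then have "\<forall>\<^sub>F n in sequentially. 4 * (1/8)^n < e\<^sup>2"
      by (intro order_tendstoD(2)[of _ 0]) (auto intro!: tendsto_eq_intros)
    then obtain n where n: "4 * (1/8)^n < e\<^sup>2" by (auto simp: eventually_sequentially)
    have "(Lp_norm 2 M (\<lambda>x. l x - g n x))\<^sup>2 < e\<^sup>2"
      using l[of n] n by (simp add: Lp_norm_2 N_def norm_minus_commute)
    then have "Lp_norm 2 M (\<lambda>x. l x - g n x) < e"
      using \<open>e > 0\<close> by (simp add: power_less_imp_less_base)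
    then show "\<exists>g\<in>F \<inter> Lp_space 2 M. Lp_norm 2 M (\<lambda>x. l x - g x) < e"
      using gV[of n] by (auto simp: V_def)
  qed
  have orth: "L2_inner M (\<lambda>x. f x - l x) h = 0" if h: "h \<in> V" for h
  proof -
    have "norm (L2_inner M (\<lambda>x. f x - l x) h) \<le> (1/2)^n * (5/2 + N h)" for n
    proof -
      \<comment> \<open>The step \<open>r\<close> tends to zero while \<open>r\<^sup>2\<close> still dominates the gap \<open>(1/8)^n\<close> to the infimum.\<close>
      define r :: real where "r = (1/2)^n"
      have r: "r > 0" "(1/8)^n \<le> r\<^sup>2"
      proof -
        show "r > 0" by (simp add: r_def)
        have "(1/8::real)^n \<le> (1/4)^n" by (intro power_mono) auto
        also have "\<dots> = r\<^sup>2"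
          unfolding r_def power2_eq_square by (simp only: power_mult_distrib[symmetric]) simp
        finally show "(1/8)^n \<le> r\<^sup>2" .
      qed
      have aL: "(\<lambda>x. f x - g n x) \<in> Lp_space 2 M" using f VL[OF gV] by (rule L2_diff)
      define I where "I = L2_inner M (\<lambda>x. f x - g n x) h"
      \<comment> \<open>Moving \<open>g n\<close> by \<open>r\<close> in the direction of \<open>h\<close> gains at most what \<open>g n\<close> misses of the infimum.\<close>
      define s where "s = of_real r * sgn I"
      have "d \<le> N (\<lambda>x. f x - (g n x + s * h x))" by (rule d_le[OF V_lin[OF gV h]])
      also have "\<dots> = N (\<lambda>x. (f x - g n x) - s * h x)" by (simp add: algebra_simps)
      also have "\<dots> = N (\<lambda>x. f x - g n x) - 2 * Re (cnj s * I) + (norm s)\<^sup>2 * N h"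
        unfolding N_def I_def by (rule L2_norm_diff_scaled[OF aL VL[OF h]])
      also have "Re (cnj s * I) = r * norm I"
      proof -
        have "cnj (sgn I) * I = of_real (norm I)"
        proof (cases "I = 0")
          case False
          have "I * cnj I = of_real (norm I) * of_real (norm I)"
            by (simp flip: complex_norm_square add: power2_eq_square)
          with False show ?thesis by (simp add: sgn_eq field_simps)
        qed simp
        then have "cnj s * I = of_real (r * norm I)" by (simp add: s_def mult.assoc)
        then show ?thesis by simp
      qed
      finally have "2 * (r * norm I) \<le> (1/8)^n + (norm s)\<^sup>2 * N h" using gd[of n] by simp
      also have "\<dots> \<le> r\<^sup>2 + r\<^sup>2 * N h"
        using r N0[of h] by (intro add_mono mult_right_mono power_mono)
          (auto simp: s_def norm_mult norm_sgn)
      finally have "r * (2 * norm I) \<le> r * (r + r * N h)"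
        by (simp add: power2_eq_square algebra_simps)
      then have I: "2 * norm I \<le> r + r * N h" using r by (simp add: mult_le_cancel_left_pos)
      have "L2_inner M (\<lambda>x. f x - l x) h = L2_inner M (\<lambda>x. (f x - g n x) + (g n x - l x)) h" by simp
      also have "\<dots> = I + L2_inner M (\<lambda>x. g n x - l x) h" unfolding I_def
        by (rule L2_inner_add_left[OF aL L2_diff[OF VL[OF gV] lL] VL[OF h]])
      finally have eq: "L2_inner M (\<lambda>x. f x - l x) h = I + L2_inner M (\<lambda>x. g n x - l x) h" .
      have "norm (L2_inner M (\<lambda>x. g n x - l x) h)
          \<le> ((1 / r) * N (\<lambda>x. g n x - l x) + N h / (1 / r)) / 2"
        unfolding N_def using r by (intro L2_inner_young L2_diff VL gV lL h) auto
      also have "(1 / r) * N (\<lambda>x. g n x - l x) \<le> (1 / r) * (4 * r\<^sup>2)"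
        using l[of n] r by (intro mult_left_mono) auto
      finally have "norm (L2_inner M (\<lambda>x. g n x - l x) h) \<le> (4 * r + r * N h) / 2"
        using r by (simp add: power2_eq_square mult.commute)
      moreover have "norm (L2_inner M (\<lambda>x. f x - l x) h) \<le> norm I + norm (L2_inner M (\<lambda>x. g n x - l x) h)"
        unfolding eq by (rule norm_triangle_ineq)
      ultimately show ?thesis using I by (simp add: r_def algebra_simps)
    qed
    moreover have "(\<lambda>n. (1/2)^n * (5/2 + N h)) \<longlonglongrightarrow> 0"
      by (auto intro!: tendsto_eq_intros)
    ultimately have "norm (L2_inner M (\<lambda>x. f x - l x) h) \<le> 0"
      by (intro LIMSEQ_le_const[of "\<lambda>n. (1/2)^n * (5/2 + N h)" 0]) auto
    then show ?thesis by simp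
  qed
  show ?thesis
    using l_cl orthogonal_to_closure[OF L2_diff[OF f lL]] orth by (auto simp: V_def)
qed

text \<open>The projection is chosen by Hilbert's operator, so its characteristic properties are available
  as soon as one witness is known.\<close>

lemma orthogonal_projection_spec:
  assumes "g \<in> H" "\<And>h. h \<in> H \<Longrightarrow> L2_inner M (\<lambda>x. f x - g x) h = 0"
  shows "orthogonal_projection M H f \<in> H"
    and "h \<in> H \<Longrightarrow> L2_inner M (\<lambda>x. f x - orthogonal_projection M H f x) h = 0"
proof -
  have "\<exists>g. g \<in> H \<and> (\<forall>h\<in>H. L2_inner M (\<lambda>x. f x - g x) h = 0)" using assms by blast
  from someI_ex[OF this]
  show "orthogonal_projection M H f \<in> H"
    and "h \<in> H \<Longrightarrow> L2_inner M (\<lambda>x. f x - orthogonal_projection M H f x) h = 0"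
    unfolding orthogonal_projection_def by auto
qed

text \<open>Testing the difference \<open>u\<close> of two projections against each of them gives \<open>\<langle>u, u\<rangle> = 0\<close>.\<close>

lemma orthogonal_projection_AE_eq:
  assumes f: "f \<in> Lp_space 2 M" and H: "H \<subseteq> Lp_space 2 M"
    and g: "g \<in> H" "\<And>h. h \<in> H \<Longrightarrow> L2_inner M (\<lambda>x. f x - g x) h = 0"
  shows "AE x in M. orthogonal_projection M H f x = g x"
proof -
  define k where "k = orthogonal_projection M H f"
  have k: "k \<in> H" "\<And>h. h \<in> H \<Longrightarrow> L2_inner M (\<lambda>x. f x - k x) h = 0"
    unfolding k_def using orthogonal_projection_spec[of g H M f] g by auto
  have L: "g \<in> Lp_space 2 M" "k \<in> Lp_space 2 M" using H g k by auto
  have "L2_inner M (\<lambda>x. k x - g x) h = 0" if "h \<in> H" for h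
  proof -
    have hL: "h \<in> Lp_space 2 M" using H that by auto
    have "L2_inner M (\<lambda>x. k x - g x) h = L2_inner M (\<lambda>x. (f x - g x) - (f x - k x)) h" by simp
    also have "\<dots> = 0" using g(2)[OF that] k(2)[OF that] hL L f
      by (subst L2_inner_diff_left) (auto intro: L2_diff)
    finally show ?thesis .
  qed
  then have "L2_inner M (\<lambda>x. k x - g x) (\<lambda>x. k x - g x) = 0"
    using g(1) k(1) L by (simp add: L2_inner_diff_right L2_diff)
  then have "(\<integral>x. (norm (k x - g x))\<^sup>2 \<partial>M) = 0"
    unfolding L2_inner_self by simp
  then have "AE x in M. (norm (k x - g x))\<^sup>2 = 0"
    using integral_nonneg_eq_0_iff_AE[of M "\<lambda>x. (norm (k x - g x))\<^sup>2"] L2_integrable[OF L2_diff[OF L(2,1)]] by auto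
  then show ?thesis unfolding k_def by auto
qed

lemma orthogonal_projection_bounded_L2:
  assumes zero: "(\<lambda>x. 0) \<in> F"
    and lin: "\<And>g h c. g \<in> F \<Longrightarrow> h \<in> F \<Longrightarrow> (\<lambda>x. g x + c * h x) \<in> F"
  shows "bounded_on_Lp 2 M (orthogonal_projection M (Lp_closure 2 M F))"
  unfolding bounded_on_Lp_def
proof (intro exI[of _ 1] conjI ballI)
  fix f assume "f \<in> Lp_space 2 M \<inter> Lp_space 2 M"
  then have f: "f \<in> Lp_space 2 M" by simp
  define H where "H = Lp_closure 2 M F"
  define k where "k = orthogonal_projection M H f"
  obtain g where "g \<in> H" "\<And>h. h \<in> H \<Longrightarrow> L2_inner M (\<lambda>x. f x - g x) h = 0"
    using orthogonal_projection_exists[of f M F, OF f zero lin] unfolding H_def by blast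
  then have k: "k \<in> H" "L2_inner M (\<lambda>x. f x - k x) k = 0"
    unfolding k_def using orthogonal_projection_spec[of g H M f] by auto
  have kL: "k \<in> Lp_space 2 M" using k(1) by (simp add: H_def Lp_closure_def)
  have "(\<integral>x. (norm (f x))\<^sup>2 \<partial>M) = (\<integral>x. (norm ((f x - k x) - (-1) * k x))\<^sup>2 \<partial>M)" by simp
  also have "\<dots> = (\<integral>x. (norm (f x - k x))\<^sup>2 \<partial>M) + (\<integral>x. (norm (k x))\<^sup>2 \<partial>M)"
    by (subst L2_norm_diff_scaled[OF L2_diff[OF f kL] kL]) (simp add: k)
  finally have "(\<integral>x. (norm (k x))\<^sup>2 \<partial>M) \<le> (\<integral>x. (norm (f x))\<^sup>2 \<partial>M)" by simp
  then have "Lp_norm 2 M k \<le> Lp_norm 2 M f"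
    unfolding Lp_norm_2[symmetric] by (rule power2_le_imp_le[OF _ Lp_norm_nonneg])
  then show "orthogonal_projection M (Lp_closure 2 M F) f \<in> Lp_space 2 M"
    "Lp_norm 2 M (orthogonal_projection M (Lp_closure 2 M F) f) \<le> 1 * Lp_norm 2 M f"
    using kL unfolding k_def H_def by auto
qed simp

section \<open>Rotations of the plane and angular means\<close>

text \<open>Identifying the plane with \<open>real^2\<close> lets the complex Lebesgue measure inherit the invariance under
  orthogonal maps.\<close>

lemma lborel_distr_Complex:
  "distr lborel borel (\<lambda>v::real^2. Complex (v $ 1) (v $ 2)) = lborel"
proof (rule lborel_eqI[symmetric])
  have [measurable]: "(\<lambda>v::real^2. Complex (v $ 1) (v $ 2)) \<in> borel_measurable borel"
    unfolding Complex_eq by (intro borel_measurable_continuous_onI continuous_intros)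
  fix l u :: complex assume lu: "\<And>b. b \<in> Basis \<Longrightarrow> l \<bullet> b \<le> u \<bullet> b"
  define l' u' where "l' = (vector [Re l, Im l] :: real^2)" and "u' = (vector [Re u, Im u] :: real^2)"
  have le: "Re l \<le> Re u" "Im l \<le> Im u" using lu[of 1] lu[of \<i>] by (auto simp: Basis_complex_def)
  have "(\<lambda>v::real^2. Complex (v $ 1) (v $ 2)) -` box l u = box l' u'"
    by (auto simp: box_def Basis_complex_def Basis_vec_def inner_axis forall_2 l'_def u'_def)
  then have "emeasure (distr lborel borel (\<lambda>v::real^2. Complex (v $ 1) (v $ 2))) (box l u)
      = emeasure lborel (box l' u')"
    by (subst emeasure_distr) auto
  also have "\<dots> = ennreal (measure lborel (cbox l' u'))"
    by (simp add: emeasure_eq_ennreal_measure emeasure_lborel_box_eq emeasure_lborel_cbox_eq measure_def top_unique)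
  also have "measure lborel (cbox l' u') = (Re u - Re l) * (Im u - Im l)"
    using le by (subst content_cbox_cart)
      (auto simp: UNIV_2 l'_def u'_def interval_ne_empty_cart forall_2)
  also have "\<dots> = (\<Prod>b\<in>Basis. (u - l) \<bullet> b)"
    by (simp add: Basis_complex_def)
  finally show "emeasure (distr lborel borel (\<lambda>v::real^2. Complex (v $ 1) (v $ 2))) (box l u)
    = ennreal (\<Prod>b\<in>Basis. (u - l) \<bullet> b)" .
qed simp

lemma lborel_distr_orthogonal:
  fixes f g :: "real^'n::{finite,wellorder} \<Rightarrow> real^'n::_"
  assumes f: "orthogonal_transformation f" and g: "orthogonal_transformation g"
    and fg: "\<And>x. f (g x) = x" and gf: "\<And>x. g (f x) = x"
  shows "distr lborel borel f = lborel"
proof (rule lborel_eqI[symmetric])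
  have [measurable]: "f \<in> borel_measurable borel"
    using orthogonal_transformation_linear[OF f] by (intro borel_measurable_continuous_onI linear_continuous_on linear_conv_bounded_linear[THEN iffD1])
  fix l u :: "real^'n::{finite,wellorder}" assume lu: "\<And>b. b \<in> Basis \<Longrightarrow> l \<bullet> b \<le> u \<bullet> b"
  have *: "f -` box l u = g ` box l u" using fg gf by (auto simp: image_iff) metis
  have b: "box l u \<in> lmeasurable" by simp
  have m: "g ` box l u \<in> lmeasurable" by (rule measurable_orthogonal_image[OF g b])
  have "f -` box l u \<inter> space lborel \<in> sets lborel" by measurable
  then have s: "g ` box l u \<in> sets lborel" using * by simp
  have "emeasure (distr lborel borel f) (box l u) = emeasure lborel (g ` box l u)"
    by (subst emeasure_distr) (auto simp: *)
  also have "\<dots> = emeasure lebesgue (g ` box l u)" using s by simp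
  also have "\<dots> = ennreal (measure lebesgue (g ` box l u))"
    using m by (intro emeasure_eq_ennreal_measure) (auto simp: fmeasurable_def)
  also have "\<dots> = emeasure lebesgue (box l u)"
    unfolding measure_orthogonal_image[OF g b]
    by (rule emeasure_eq_ennreal_measure[symmetric]) (simp add: emeasure_lborel_box_eq)
  also have "\<dots> = (\<Prod>b\<in>Basis. (u - l) \<bullet> b)"
    using lu by simp
  finally show "emeasure (distr lborel borel f) (box l u) = ennreal (\<Prod>b\<in>Basis. (u - l) \<bullet> b)" .
qed simp

lemma lborel_distr_unimodular_mult:
  fixes c :: complex
  assumes c: "norm c = 1"
  shows "distr lborel borel (\<lambda>z. c * z) = lborel"
proof -
  define J where "J v = Complex (v $ 1) (v $ 2)" for v :: "real^2"
  define J' where "J' z = (vector [Re z, Im z] :: real^2)" for z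
  have JJ': "J (J' z) = z" for z by (simp add: J_def J'_def)
  have J'J: "J' (J v) = v" for v by (simp add: J_def J'_def vec_eq_iff forall_2)
  have [measurable]: "J \<in> borel_measurable borel"
    unfolding J_def Complex_eq by (intro borel_measurable_continuous_onI continuous_intros)
  define R where "R d v = J' (d * J v)" for d v
  have orth: "orthogonal_transformation (R d)" if "norm d = 1" for d
  proof -
    have "linear (R d)"
      by (rule linearI) (auto simp: R_def J_def J'_def vec_eq_iff forall_2 algebra_simps)
    moreover have "norm (R d v) = norm v" for v
    proof -
      have n: "norm (J' z) = norm z" for z
        by (simp add: J'_def norm_vec_def L2_set_def UNIV_2 cmod_def)
      have "norm (R d v) = norm (J' (J v))" using that by (simp add: R_def n norm_mult)
      then show ?thesis by (simp add: J'J)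
    qed
    ultimately show ?thesis by (simp add: orthogonal_transformation)
  qed
  have inv: "R d (R e v) = v" if "d * e = 1" for d e v
    using that by (simp add: R_def JJ' J'J mult.assoc[symmetric])
  have c': "c * cnj c = 1" "cnj c * c = 1" using c complex_norm_square[of c] by (auto simp: mult.commute)
  have R: "distr lborel borel (R c) = lborel"
    by (rule lborel_distr_orthogonal[of "R c" "R (cnj c)"]) (use c c' in \<open>auto intro: orth inv\<close>)
  have [measurable]: "R c \<in> borel_measurable borel"
    using orthogonal_transformation_linear[OF orth[OF c]] by (intro borel_measurable_continuous_onI linear_continuous_on linear_conv_bounded_linear[THEN iffD1])
  have J: "distr lborel borel J = lborel" unfolding J_def by (rule lborel_distr_Complex)
  have "distr lborel borel (\<lambda>z. c * z) = distr (distr lborel borel J) borel (\<lambda>z. c * z)"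
    by (simp add: J)
  also have "\<dots> = distr lborel borel ((\<lambda>z. c * z) \<circ> J)" by (rule distr_distr) auto
  also have "(\<lambda>z. c * z) \<circ> J = J \<circ> R c" by (auto simp: R_def JJ')
  also have "distr lborel borel (J \<circ> R c) = distr (distr lborel borel (R c)) borel J"
    by (rule distr_distr[symmetric]) auto
  finally show ?thesis by (simp add: R J)
qed

lemma continuous_on_cis_compose:
  "continuous_on S g \<Longrightarrow> continuous_on S (\<lambda>x. cis (g x))"
  unfolding cis_conv_exp by (intro continuous_intros)

text \<open>This is the Cauchy formula for the \<open>n\<close>-th Taylor coefficient, written as an angular mean. The case
  \<open>n = 0\<close> is the mean value property, needed up to the boundary circle.\<close>

lemma circle_integral_coeff:
  fixes f :: "complex \<Rightarrow> complex"
  assumes r: "r > 0" and cont: "continuous_on (cball 0 r) f" and hol: "f holomorphic_on ball 0 r"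
  shows "(\<integral>\<theta>. f (of_real r * cis \<theta>) * cis (- (real n * \<theta>)) \<partial>restrict_space lborel {0..2*pi})
    = of_real (2 * pi) * of_real r ^ n * (deriv ^^ n) f 0 / fact n"
proof -
  have cis_n: "cis (- (real n * \<theta>)) = inverse (cis \<theta> ^ n)" for \<theta>
    by (simp add: Complex.DeMoivre cis_inverse)
  have c: "continuous_on {0..2*pi} (\<lambda>\<theta>. f (of_real r * cis \<theta>) * cis (- (real n * \<theta>)))"
    by (intro continuous_on_mult continuous_on_cis_compose continuous_on_compose2[OF cont] continuous_intros) (use r in \<open>auto simp: norm_mult\<close>)
  have "((\<lambda>u. f u / (u - 0) ^ Suc n) has_contour_integral ((2 * pi * \<i>) / (fact n) * (deriv ^^ n) f 0))
         (part_circlepath 0 r 0 (2*pi))"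
    using Cauchy_has_contour_integral_higher_derivative_circlepath[OF cont hol, of 0 n] r
    by (simp add: circlepath_def)
  then have "((\<lambda>\<theta>. f (0 + of_real r * cis \<theta>) / (0 + of_real r * cis \<theta> - 0) ^ Suc n * r * \<i> * cis \<theta>)
      has_integral ((2 * pi * \<i>) / (fact n) * (deriv ^^ n) f 0)) {0..2*pi}"
    by (subst (asm) has_contour_integral_part_circlepath_iff) auto
  then have "((\<lambda>\<theta>. (of_real r ^ n / \<i>) * (f (0 + of_real r * cis \<theta>) / (0 + of_real r * cis \<theta> - 0) ^ Suc n * r * \<i> * cis \<theta>))
      has_integral ((of_real r ^ n / \<i>) * ((2 * pi * \<i>) / (fact n) * (deriv ^^ n) f 0))) {0..2*pi}"
    by (rule has_integral_mult_right)
  also have "(\<lambda>\<theta>. (of_real r ^ n / \<i>) * (f (0 + of_real r * cis \<theta>) / (0 + of_real r * cis \<theta> - 0) ^ Suc n * r * \<i> * cis \<theta>))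
     = (\<lambda>\<theta>. f (of_real r * cis \<theta>) * cis (- (real n * \<theta>)))"
    unfolding cis_n using r by (auto simp: fun_eq_iff field_simps power_mult_distrib)
  finally have h: "((\<lambda>\<theta>. f (of_real r * cis \<theta>) * cis (- (real n * \<theta>))) has_integral
      ((of_real r ^ n / \<i>) * ((2 * pi * \<i>) / (fact n) * (deriv ^^ n) f 0))) {0..2*pi}" .
  have "(\<integral>\<theta>. f (of_real r * cis \<theta>) * cis (- (real n * \<theta>)) \<partial>restrict_space lborel {0..2*pi})
    = (LINT \<theta>:{0..2*pi}|lborel. f (of_real r * cis \<theta>) * cis (- (real n * \<theta>)))"
    by (simp add: integral_restrict_space set_lebesgue_integral_def)
  also have "\<dots> = integral {0..2*pi} (\<lambda>\<theta>. f (of_real r * cis \<theta>) * cis (- (real n * \<theta>)))"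
    by (rule set_borel_integral_eq_integral(2)) (rule borel_integrable_atLeastAtMost'[OF c])
  also have "\<dots> = (of_real r ^ n / \<i>) * ((2 * pi * \<i>) / (fact n) * (deriv ^^ n) f 0)"
    by (rule integral_unique[OF h])
  finally show ?thesis by (simp add: field_simps)
qed

text \<open>Averaging \<open>H\<close> over rotations against a character isolates the \<open>n\<close>-th term of its Taylor series.\<close>

lemma circle_integral_coeff_disc:
  assumes H: "H holomorphic_on ball 0 1" and z: "z \<in> ball 0 1"
  shows "(\<integral>\<theta>. H (cis \<theta> * z) * cis (- (real n * \<theta>)) \<partial>restrict_space lborel {0..2*pi})
    = of_real (2 * pi) * (deriv ^^ n) H 0 / fact n * z ^ n"
proof -
  define S where "S = (\<lambda>w. z * w + 0) -` ball 0 1"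
  have S: "open S" unfolding S_def by (intro open_vimage continuous_intros) auto
  have sub: "cball 0 1 \<subseteq> S"
  proof
    fix w :: complex assume "w \<in> cball 0 1"
    then have "norm z * norm w \<le> norm z * 1" by (intro mult_left_mono) auto
    also have "\<dots> < 1" using z by simp
    finally show "w \<in> S" by (simp add: S_def norm_mult)
  qed
  have hol: "(\<lambda>w. H (z * w + 0)) holomorphic_on S"
    by (rule holomorphic_on_compose_gen[OF _ H, unfolded o_def])
       (auto intro!: holomorphic_intros simp: S_def)
  have "(\<integral>\<theta>. H (z * (of_real 1 * cis \<theta>) + 0) * cis (- (real n * \<theta>)) \<partial>restrict_space lborel {0..2*pi})
     = of_real (2 * pi) * of_real 1 ^ n * (deriv ^^ n) (\<lambda>w. H (z * w + 0)) 0 / fact n"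
    using sub ball_subset_cball[of "0::complex" 1]
    by (intro circle_integral_coeff holomorphic_on_imp_continuous_on holomorphic_on_subset[OF hol]) auto
  also have "(deriv ^^ n) (\<lambda>w. H (z * w + 0)) 0 = z ^ n * (deriv ^^ n) H (z * 0 + 0)"
    by (rule higher_deriv_compose_linear'[OF H S]) (use sub in \<open>auto simp: S_def\<close>)
  finally show ?thesis by (simp add: mult_ac)
qed

section \<open>Integration over the boundary of a Hartogs domain\<close>

abbreviation disc_measure :: "complex measure" where
  "disc_measure \<equiv> restrict_space lborel (ball 0 1)"

abbreviation angle_measure :: "real measure" where
  "angle_measure \<equiv> restrict_space lborel {0..2*pi}"

definition area_factor :: "(complex \<Rightarrow> real) \<Rightarrow> complex \<Rightarrow> real" where
  "area_factor \<phi> z = \<phi> z * sqrt (1 + (norm (gradient \<phi> z))\<^sup>2)"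

lemma finite_measure_disc: "finite_measure disc_measure"
  using emeasure_lborel_ball_finite[of "0::complex" 1]
  by (intro finite_measureI) (simp add: emeasure_restrict_space space_restrict_space)

lemma finite_measure_angle: "finite_measure angle_measure"
  by (intro finite_measureI) (simp add: emeasure_restrict_space space_restrict_space)

lemma measure_angle: "measure angle_measure (space angle_measure) = 2 * pi"
  by (simp add: measure_restrict_space space_restrict_space)

lemma disc_integral_rotate:
  fixes v :: "complex \<Rightarrow> 'b::{banach, second_countable_topology}"
  assumes c: "norm c = 1" and v: "v \<in> borel_measurable disc_measure"
  shows "(\<integral>z. v (c * z) \<partial>disc_measure) = (\<integral>z. v z \<partial>disc_measure)"
proof -
  have m: "(\<lambda>z. indicator (ball 0 1) z *\<^sub>R v z) \<in> borel_measurable borel"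
    using v by (subst (asm) borel_measurable_restrict_space_iff) auto
  have [measurable]: "(\<lambda>z. c * z) \<in> borel_measurable borel"
    by (intro borel_measurable_continuous_onI continuous_intros)
  have "(\<integral>z. v z \<partial>disc_measure) = (\<integral>z. indicator (ball 0 1) z *\<^sub>R v z \<partial>distr lborel borel (\<lambda>z. c * z))"
    unfolding lborel_distr_unimodular_mult[OF c] by (rule integral_restrict_space) simp
  also have "\<dots> = (\<integral>z. indicator (ball 0 1) (c * z) *\<^sub>R v (c * z) \<partial>lborel)"
    by (rule integral_distr) (use m in auto)
  also have "(\<lambda>z. indicator (ball 0 1) (c * z) *\<^sub>R v (c * z)) = (\<lambda>z. indicator (ball 0 1) z *\<^sub>R v (c * z))"
    using c by (auto simp: indicator_def norm_mult fun_eq_iff)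
  also have "(\<integral>z. indicator (ball 0 1) z *\<^sub>R v (c * z) \<partial>lborel) = (\<integral>z. v (c * z) \<partial>disc_measure)"
    by (rule integral_restrict_space[symmetric]) simp
  finally show ?thesis by simp
qed

text \<open>The profiles for which the projection can be computed by symmetry: the slices in the second
  variable are discs, and the surface density over the disc is invariant under rotations.\<close>

locale circular_profile =
  fixes \<phi> :: "complex \<Rightarrow> real"
  assumes pos: "z \<in> ball 0 1 \<Longrightarrow> 0 < \<phi> z"
    and cont: "continuous_on (ball 0 1) \<phi>"
    and area_cont: "continuous_on (ball 0 1) (area_factor \<phi>)"
    and area_bounded: "\<exists>K. \<forall>z\<in>ball 0 1. area_factor \<phi> z \<le> K"
    and area_rotate: "\<lbrakk>norm c = 1; z \<in> ball 0 1\<rbrakk> \<Longrightarrow> area_factor \<phi> (c * z) = area_factor \<phi> z"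
begin

abbreviation "\<sigma> \<equiv> surface_measure \<phi>"
abbreviation "\<Omega> \<equiv> Hartogs_domain \<phi>"
abbreviation "area \<equiv> area_factor \<phi>"

definition param :: "complex \<times> real \<Rightarrow> complex \<times> complex" where
  "param = (\<lambda>(z, \<theta>). (z, cis \<theta> * complex_of_real (\<phi> z)))"

lemma profile_le_area: "z \<in> ball 0 1 \<Longrightarrow> \<phi> z \<le> area z"
  using pos[of z] by (simp add: area_factor_def mult_le_cancel_left1)

lemma area_pos: "z \<in> ball 0 1 \<Longrightarrow> 0 < area z"
  using pos[of z] profile_le_area[of z] by linarith

lemma slice_in_closure:
  assumes z: "z \<in> ball 0 1" and w: "norm w \<le> \<phi> z"
  shows "(z, w) \<in> closure \<Omega>"
proof -
  have "w \<in> closure (ball 0 (\<phi> z))" using w pos[OF z] by simp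
  then have "(z, w) \<in> closure ({z} \<times> ball 0 (\<phi> z))" by (simp add: closure_Times)
  also have "\<dots> \<subseteq> closure \<Omega>"
    using z by (intro closure_mono) (auto simp: Hartogs_domain_def)
  finally show ?thesis .
qed

lemma param_in_frontier: "z \<in> ball 0 1 \<Longrightarrow> param (z, \<theta>) \<in> frontier \<Omega>"
  using slice_in_closure[of z "cis \<theta> * complex_of_real (\<phi> z)"] pos[of z] interior_subset[of \<Omega>]
  by (force simp: frontier_def param_def Hartogs_domain_def norm_mult)

lemma profile_measurable [measurable]: "\<phi> \<in> borel_measurable disc_measure"
  using borel_measurable_continuous_on_restrict[OF cont] by simp

lemma area_measurable [measurable]: "area \<in> borel_measurable disc_measure"
  using borel_measurable_continuous_on_restrict[OF area_cont] by simp

lemma id_measurable_disc [measurable]: "(\<lambda>z. z) \<in> measurable disc_measure borel"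
  by (simp add: measurable_restrict_space1)

lemma cis_measurable_angle [measurable]: "cis \<in> measurable angle_measure borel"
  by (rule measurable_restrict_space1)
     (auto intro!: borel_measurable_continuous_onI continuous_on_cis_compose continuous_on_id)

lemma param_measurable [measurable]:
  "param \<in> measurable (disc_measure \<Otimes>\<^sub>M angle_measure) (restrict_space borel (frontier \<Omega>))"
proof (rule measurable_restrict_space2)
  show "param \<in> space (disc_measure \<Otimes>\<^sub>M angle_measure) \<rightarrow> frontier \<Omega>"
    using param_in_frontier by (auto simp: space_pair_measure space_restrict_space)
  have "(\<lambda>x. (fst x, cis (snd x) * complex_of_real (\<phi> (fst x))))
      \<in> measurable (disc_measure \<Otimes>\<^sub>M angle_measure) (borel \<Otimes>\<^sub>M borel)"
    by measurable
  then show "param \<in> borel_measurable (disc_measure \<Otimes>\<^sub>M angle_measure)"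
    by (simp add: param_def case_prod_unfold borel_prod)
qed

lemma surface_measure_eq:
  "\<sigma> = distr (density (disc_measure \<Otimes>\<^sub>M angle_measure) (\<lambda>x. ennreal (area (fst x))))
     (restrict_space borel (frontier \<Omega>)) param"
  by (simp add: surface_measure_def param_def area_factor_def case_prod_unfold)

lemma sets_surface [measurable_cong]: "sets \<sigma> = sets (restrict_space borel (frontier \<Omega>))"
  by (simp add: surface_measure_eq)

lemma finite_surface: "finite_measure \<sigma>"
proof -
  interpret DT: finite_measure "disc_measure \<Otimes>\<^sub>M angle_measure"
    by (intro finite_measure_pair_measure finite_measure_disc finite_measure_angle)
  obtain K where K: "\<And>z. z \<in> ball 0 1 \<Longrightarrow> area z \<le> K" using area_bounded by blast
  have "(\<integral>\<^sup>+x. ennreal (area (fst x)) \<partial>(disc_measure \<Otimes>\<^sub>M angle_measure))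
      \<le> (\<integral>\<^sup>+x. ennreal K \<partial>(disc_measure \<Otimes>\<^sub>M angle_measure))"
    using K by (intro nn_integral_mono ennreal_leI) (auto simp: space_pair_measure space_restrict_space)
  also have "\<dots> < \<infinity>"
    using DT.emeasure_finite by (simp add: ennreal_mult_eq_top_iff flip: top.not_eq_extremum)
  finally have fin: "(\<integral>\<^sup>+x. ennreal (area (fst x)) \<partial>(disc_measure \<Otimes>\<^sub>M angle_measure)) < \<infinity>" .
  have "finite_measure (density (disc_measure \<Otimes>\<^sub>M angle_measure) (\<lambda>x. ennreal (area (fst x))))"
  proof (rule finite_measureI)
    let ?M = "density (disc_measure \<Otimes>\<^sub>M angle_measure) (\<lambda>x. ennreal (area (fst x)))"
    have "emeasure ?M (space ?M) = (\<integral>\<^sup>+x. ennreal (area (fst x)) \<partial>(disc_measure \<Otimes>\<^sub>M angle_measure))"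
      by (subst emeasure_density) (auto intro!: nn_integral_cong)
    then show "emeasure ?M (space ?M) \<noteq> \<infinity>" using fin by simp
  qed
  then show ?thesis
    unfolding surface_measure_eq by (rule finite_measure.finite_measure_distr) simp
qed

lemma integral_surface:
  fixes f :: "complex \<times> complex \<Rightarrow> 'b::{banach, second_countable_topology}"
  assumes f[measurable]: "f \<in> borel_measurable (restrict_space borel (frontier \<Omega>))"
  shows "(\<integral>x. f x \<partial>\<sigma>) = (\<integral>x. area (fst x) *\<^sub>R f (param x) \<partial>(disc_measure \<Otimes>\<^sub>M angle_measure))"
proof -
  have m: "(\<lambda>x. f (param x)) \<in> borel_measurable (disc_measure \<Otimes>\<^sub>M angle_measure)"
    by measurable
  have "(\<integral>x. f x \<partial>\<sigma>) = (\<integral>x. f (param x) \<partial>density (disc_measure \<Otimes>\<^sub>M angle_measure) (\<lambda>x. ennreal (area (fst x))))"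
    unfolding surface_measure_eq by (rule integral_distr) auto
  also have "\<dots> = (\<integral>x. area (fst x) *\<^sub>R f (param x) \<partial>(disc_measure \<Otimes>\<^sub>M angle_measure))"
    by (rule integral_density[OF m])
       (auto intro!: AE_I2 less_imp_le area_pos simp: space_pair_measure space_restrict_space)
  finally show ?thesis .
qed

lemma integrable_bounded_disc_angle:
  fixes f :: "complex \<times> real \<Rightarrow> 'b::{banach, second_countable_topology}"
  assumes "f \<in> borel_measurable (disc_measure \<Otimes>\<^sub>M angle_measure)"
    and "\<And>z \<theta>. z \<in> ball 0 1 \<Longrightarrow> norm (f (z, \<theta>)) \<le> K"
  shows "integrable (disc_measure \<Otimes>\<^sub>M angle_measure) f"
proof -
  interpret DT: finite_measure "disc_measure \<Otimes>\<^sub>M angle_measure"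
    by (intro finite_measure_pair_measure finite_measure_disc finite_measure_angle)
  show ?thesis
    by (rule DT.integrable_const_bound[of _ K])
       (use assms in \<open>auto intro!: AE_I2 simp: space_pair_measure space_restrict_space\<close>)
qed

lemma Fubini_disc_angle:
  fixes f :: "complex \<times> real \<Rightarrow> 'b::{banach, second_countable_topology}"
  assumes "f \<in> borel_measurable (disc_measure \<Otimes>\<^sub>M angle_measure)"
    and "\<And>z \<theta>. z \<in> ball 0 1 \<Longrightarrow> norm (f (z, \<theta>)) \<le> K"
  shows "(\<integral>x. f x \<partial>(disc_measure \<Otimes>\<^sub>M angle_measure)) = (\<integral>z. (\<integral>\<theta>. f (z, \<theta>) \<partial>angle_measure) \<partial>disc_measure)"
    and "(\<integral>x. f x \<partial>(disc_measure \<Otimes>\<^sub>M angle_measure)) = (\<integral>\<theta>. (\<integral>z. f (z, \<theta>) \<partial>disc_measure) \<partial>angle_measure)"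
proof -
  interpret D: finite_measure disc_measure by (rule finite_measure_disc)
  interpret T: finite_measure angle_measure by (rule finite_measure_angle)
  interpret P: pair_sigma_finite disc_measure angle_measure ..
  have i: "integrable (disc_measure \<Otimes>\<^sub>M angle_measure) f"
    by (rule integrable_bounded_disc_angle[OF assms])
  show "(\<integral>x. f x \<partial>(disc_measure \<Otimes>\<^sub>M angle_measure)) = (\<integral>z. (\<integral>\<theta>. f (z, \<theta>) \<partial>angle_measure) \<partial>disc_measure)"
    by (rule P.integral_fst'[OF i, symmetric])
  have "integrable (disc_measure \<Otimes>\<^sub>M angle_measure) (\<lambda>(z, \<theta>). f (z, \<theta>))" using i by simp
  from P.integral_snd[OF this]
  show "(\<integral>x. f x \<partial>(disc_measure \<Otimes>\<^sub>M angle_measure)) = (\<integral>\<theta>. (\<integral>z. f (z, \<theta>) \<partial>disc_measure) \<partial>angle_measure)"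
    by simp
qed

lemma fst_measurable_frontier:
  assumes u: "u \<in> borel_measurable borel"
  shows "(\<lambda>x. u (fst x)) \<in> borel_measurable (restrict_space borel (frontier \<Omega>))"
  by (rule measurable_restrict_space1, rule measurable_compose[OF _ u])
     (rule borel_measurable_continuous_onI[OF continuous_on_fst[OF continuous_on_id]])

lemma integral_surface_fst:
  fixes u :: "complex \<Rightarrow> 'b::{banach, second_countable_topology}"
  assumes u[measurable]: "u \<in> borel_measurable borel" and bnd: "\<And>z. z \<in> ball 0 1 \<Longrightarrow> norm (u z) \<le> L"
  shows "(\<integral>x. u (fst x) \<partial>\<sigma>) = (2 * pi) *\<^sub>R (\<integral>z. area z *\<^sub>R u z \<partial>disc_measure)"
proof -
  obtain K where K: "\<And>z. z \<in> ball 0 1 \<Longrightarrow> area z \<le> K" using area_bounded by blast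
  have [measurable]: "u \<in> borel_measurable disc_measure"
    by (simp add: measurable_restrict_space1)
  have "(\<integral>x. u (fst x) \<partial>\<sigma>) = (\<integral>x. area (fst x) *\<^sub>R u (fst (param x)) \<partial>(disc_measure \<Otimes>\<^sub>M angle_measure))"
    by (rule integral_surface[OF fst_measurable_frontier[OF u]])
  also have "\<dots> = (\<integral>x. area (fst x) *\<^sub>R u (fst x) \<partial>(disc_measure \<Otimes>\<^sub>M angle_measure))"
    by (simp add: param_def case_prod_unfold)
  also have "\<dots> = (\<integral>z. (\<integral>\<theta>. area z *\<^sub>R u z \<partial>angle_measure) \<partial>disc_measure)"
  proof (subst Fubini_disc_angle(1)[where K = "K * L"])
    fix z :: complex assume z: "z \<in> ball 0 1"
    show "norm (area (fst (z, \<theta>)) *\<^sub>R u (fst (z, \<theta>))) \<le> K * L" for \<theta> :: real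
      using K[OF z] bnd[OF z] area_pos[OF z] by (simp add: mult_mono)
  qed auto
  also have "\<dots> = (\<integral>z. (2 * pi) *\<^sub>R (area z *\<^sub>R u z) \<partial>disc_measure)"
    using measure_angle by (simp add: mult.commute)
  also have "\<dots> = (2 * pi) *\<^sub>R (\<integral>z. area z *\<^sub>R u z \<partial>disc_measure)"
    by (rule integral_scaleR_right)
  finally show ?thesis .
qed

lemma bounded_closure: "bounded (closure \<Omega>)"
proof -
  obtain K where K: "\<And>z. z \<in> ball 0 1 \<Longrightarrow> area z \<le> K" using area_bounded by blast
  have "\<Omega> \<subseteq> ball 0 1 \<times> ball 0 K"
    using K profile_le_area by (fastforce simp: Hartogs_domain_def)
  then show ?thesis
    using bounded_Times[OF bounded_ball bounded_ball] bounded_subset bounded_closure by blast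
qed

lemma continuous_closure_bounded:
  fixes h :: "complex \<times> complex \<Rightarrow> complex"
  assumes "continuous_on (closure \<Omega>) h"
  shows "\<exists>L\<ge>0. \<forall>x\<in>closure \<Omega>. norm (h x) \<le> L"
proof -
  have "compact (h ` closure \<Omega>)"
    using assms bounded_closure by (intro compact_continuous_image) (simp_all add: compact_eq_bounded_closed)
  then obtain L where "\<forall>y\<in>h ` closure \<Omega>. norm y \<le> L"
    using compact_imp_bounded bounded_iff by metis
  then have "\<forall>x\<in>closure \<Omega>. norm (h x) \<le> max L 0" by auto
  then show ?thesis by (intro exI[of _ "max L 0"]) auto
qed

lemma holomorphic_slices:
  assumes h: "holomorphic_on_C2 h \<Omega>" and hc: "continuous_on (closure \<Omega>) h"
  shows "(\<lambda>z. h (z, 0)) holomorphic_on ball 0 1"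
    and "z \<in> ball 0 1 \<Longrightarrow> (\<lambda>w. h (z, w)) holomorphic_on ball 0 (\<phi> z)"
    and "z \<in> ball 0 1 \<Longrightarrow> continuous_on (cball 0 (\<phi> z)) (\<lambda>w. h (z, w))"
proof -
  have "\<exists>a. ((\<lambda>z. h (z, 0)) has_field_derivative a) (at z)" if z: "z \<in> ball 0 1" for z
  proof -
    have "(z, 0) \<in> \<Omega>" using z pos[OF z] by (simp add: Hartogs_domain_def)
    then obtain a b where d: "(h has_derivative (\<lambda>k. a * fst k + b * snd k)) (at (z, 0))"
      using h by (auto simp: holomorphic_on_C2_def)
    have "((\<lambda>z. (z, 0::complex)) has_derivative (\<lambda>k. (k, 0))) (at z)"
      by (auto intro!: derivative_eq_intros)
    from has_derivative_compose[OF this d] show ?thesis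
      unfolding has_field_derivative_def by auto
  qed
  then show "(\<lambda>z. h (z, 0)) holomorphic_on ball 0 1"
    by (intro holomorphic_onI) (auto simp: field_differentiable_def intro: has_field_derivative_at_within)
  assume z: "z \<in> ball 0 1"
  have "\<exists>a. ((\<lambda>w. h (z, w)) has_field_derivative a) (at w)" if w: "w \<in> ball 0 (\<phi> z)" for w
  proof -
    have "(z, w) \<in> \<Omega>" using z w by (simp add: Hartogs_domain_def)
    then obtain a b where d: "(h has_derivative (\<lambda>k. a * fst k + b * snd k)) (at (z, w))"
      using h by (auto simp: holomorphic_on_C2_def)
    have "((\<lambda>w. (z, w)) has_derivative (\<lambda>k. (0, k))) (at w)"
      by (auto intro!: derivative_eq_intros)
    from has_derivative_compose[OF this d] show ?thesis
      unfolding has_field_derivative_def by auto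
  qed
  then show "(\<lambda>w. h (z, w)) holomorphic_on ball 0 (\<phi> z)"
    by (intro holomorphic_onI) (auto simp: field_differentiable_def intro: has_field_derivative_at_within)
  show "continuous_on (cball 0 (\<phi> z)) (\<lambda>w. h (z, w))"
    by (rule continuous_on_compose2[OF hc]) (use z slice_in_closure in \<open>auto intro!: continuous_intros\<close>)
qed

text \<open>The mean over the circle \<open>\<bar>w\<bar> = \<phi>(z)\<close> replaces \<open>h(z, w)\<close> by \<open>h(z, 0)\<close>. Rotating \<open>z\<close>, under which
  \<open>u\<close> picks up the factor \<open>c\<^sup>n\<close>, then keeps only the term \<open>z\<^sup>n\<close> in the Taylor series of \<open>h(z, 0)\<close>. So
  \<open>u\<close> is orthogonal to all of the holomorphic functions once it is orthogonal to \<open>z\<^sup>n\<close>.\<close>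

lemma fst_L2_inner_holomorphic_eq_0:
  fixes u :: "complex \<Rightarrow> complex"
  assumes u[measurable]: "u \<in> borel_measurable borel" and bnd: "\<And>z. z \<in> ball 0 1 \<Longrightarrow> norm (u z) \<le> U"
    and hom: "\<And>c z. norm c = 1 \<Longrightarrow> u (c * z) = c ^ n * u z"
    and zero: "(\<integral>z. area z *\<^sub>R (u z * cnj (z ^ n)) \<partial>disc_measure) = 0"
    and h: "holomorphic_on_C2 h \<Omega>" and hc: "continuous_on (closure \<Omega>) h"
  shows "L2_inner \<sigma> (\<lambda>x. u (fst x)) h = 0"
proof -
  obtain K where K: "\<And>z. z \<in> ball 0 1 \<Longrightarrow> area z \<le> K" using area_bounded by blast
  obtain L where L: "L \<ge> 0" "\<And>x. x \<in> closure \<Omega> \<Longrightarrow> norm (h x) \<le> L"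
    using continuous_closure_bounded[OF hc] by blast
  have K0: "K \<ge> 0" using K[of 0] area_pos[of 0] by simp
  have U0: "U \<ge> 0" by (rule order_trans[OF norm_ge_zero bnd[of 0]]) simp
  note slices = holomorphic_slices[OF h hc]
  have [measurable]: "u \<in> borel_measurable disc_measure"
    by (simp add: measurable_restrict_space1)
  have hm[measurable]: "h \<in> borel_measurable (restrict_space borel (frontier \<Omega>))"
    by (rule borel_measurable_continuous_on_restrict)
       (rule continuous_on_subset[OF hc], simp add: frontier_def)
  define H where "H z = h (z, 0)" for z
  have H: "H holomorphic_on ball 0 1" unfolding H_def by (rule slices(1))
  have Hm[measurable]: "H \<in> borel_measurable disc_measure"
    using borel_measurable_continuous_on_restrict[OF holomorphic_on_imp_continuous_on[OF H]] by simp
  have HL: "norm (H z) \<le> L" if "z \<in> ball 0 1" for z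
    unfolding H_def using that pos[OF that] by (intro L(2) slice_in_closure) auto
  define v where "v z = area z *\<^sub>R (u z * cnj (H z))" for z
  have vm[measurable]: "v \<in> borel_measurable disc_measure" unfolding v_def by measurable
  have v_bound: "norm (v z) \<le> K * (U * L)" if "z \<in> ball 0 1" for z
    using K[OF that] bnd[OF that] HL[OF that] area_pos[OF that] U0 K0
    by (auto simp: v_def norm_mult intro!: mult_mono)
  have "L2_inner \<sigma> (\<lambda>x. u (fst x)) h
      = (\<integral>x. area (fst x) *\<^sub>R (u (fst (param x)) * cnj (h (param x))) \<partial>(disc_measure \<Otimes>\<^sub>M angle_measure))"
    unfolding L2_inner_def
    by (rule integral_surface) (use fst_measurable_frontier[OF u] in measurable)
  also have "\<dots> = (\<integral>x. area (fst x) *\<^sub>R (u (fst x) * cnj (h (param x))) \<partial>(disc_measure \<Otimes>\<^sub>M angle_measure))"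
    by (simp add: param_def case_prod_unfold)
  also have "\<dots> = (\<integral>z. (\<integral>\<theta>. area z *\<^sub>R (u z * cnj (h (param (z, \<theta>)))) \<partial>angle_measure) \<partial>disc_measure)"
  proof (subst Fubini_disc_angle(1)[where K = "K * (U * L)"])
    fix z :: complex and \<theta> :: real assume z: "z \<in> ball 0 1"
    have "norm (h (param (z, \<theta>))) \<le> L"
      using param_in_frontier[OF z] by (intro L(2)) (simp add: frontier_def)
    then show "norm (area (fst (z, \<theta>)) *\<^sub>R (u (fst (z, \<theta>)) * cnj (h (param (z, \<theta>))))) \<le> K * (U * L)"
      using K[OF z] bnd[OF z] area_pos[OF z] U0 K0
      by (auto simp: norm_mult intro!: mult_mono)
  qed auto
  also have "\<dots> = (\<integral>z. (2 * pi) *\<^sub>R v z \<partial>disc_measure)"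
  proof (rule Bochner_Integration.integral_cong[OF refl])
    fix z assume "z \<in> space disc_measure"
    then have z: "z \<in> ball 0 1" by (simp add: space_restrict_space)
    have "(\<integral>\<theta>. h (z, of_real (\<phi> z) * cis \<theta>) * cis (- (real 0 * \<theta>)) \<partial>angle_measure) = of_real (2 * pi) * H z"
      using circle_integral_coeff[OF pos[OF z] slices(3)[OF z] slices(2)[OF z], of 0] by (simp add: H_def)
    then have "(\<integral>\<theta>. h (param (z, \<theta>)) \<partial>angle_measure) = of_real (2 * pi) * H z"
      by (simp add: param_def mult.commute)
    then have "(\<integral>\<theta>. cnj (h (param (z, \<theta>))) \<partial>angle_measure) = of_real (2 * pi) * cnj (H z)"
      by (simp add: integral_cnj)
    then show "(\<integral>\<theta>. area z *\<^sub>R (u z * cnj (h (param (z, \<theta>)))) \<partial>angle_measure) = (2 * pi) *\<^sub>R v z"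
      by (simp add: v_def scaleR_conv_of_real mult_ac)
  qed
  also have "\<dots> = (\<integral>\<theta>. (\<integral>z. v (cis \<theta> * z) \<partial>disc_measure) \<partial>angle_measure)"
    using measure_angle by (simp add: disc_integral_rotate)
  also have "\<dots> = (\<integral>z. (\<integral>\<theta>. v (cis \<theta> * z) \<partial>angle_measure) \<partial>disc_measure)"
  proof -
    have "(\<lambda>x. cis (snd x) * fst x) \<in> measurable (disc_measure \<Otimes>\<^sub>M angle_measure) disc_measure"
    proof (rule measurable_restrict_space2)
      show "(\<lambda>x. cis (snd x) * fst x) \<in> space (disc_measure \<Otimes>\<^sub>M angle_measure) \<rightarrow> ball 0 1"
        by (auto simp: space_pair_measure space_restrict_space norm_mult)
    qed measurable
    from measurable_compose[OF this vm]
    have m: "(\<lambda>x. v (cis (snd x) * fst x)) \<in> borel_measurable (disc_measure \<Otimes>\<^sub>M angle_measure)" .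
    have b: "norm (v (cis (snd (z, \<theta>)) * fst (z, \<theta>))) \<le> K * (U * L)" if "z \<in> ball 0 1" for z :: complex and \<theta> :: real
      using that by (intro v_bound) (simp add: norm_mult)
    show ?thesis
      using Fubini_disc_angle(1)[OF m b] Fubini_disc_angle(2)[OF m b] by simp
  qed
  also have "\<dots> = (\<integral>z. cnj (of_real (2 * pi) * (deriv ^^ n) H 0 / fact n) * (area z *\<^sub>R (u z * cnj (z ^ n))) \<partial>disc_measure)"
  proof (rule Bochner_Integration.integral_cong[OF refl])
    fix z assume "z \<in> space disc_measure"
    then have z: "z \<in> ball 0 1" by (simp add: space_restrict_space)
    have "v (cis \<theta> * z) = area z *\<^sub>R (u z * cnj (H (cis \<theta> * z) * cis (- (real n * \<theta>))))" for \<theta>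
    proof -
      have "area (cis \<theta> * z) = area z" by (rule area_rotate[OF _ z]) simp
      moreover have "u (cis \<theta> * z) = cis (real n * \<theta>) * u z" by (subst hom) (simp_all add: Complex.DeMoivre)
      ultimately show ?thesis by (simp add: v_def cis_cnj mult_ac)
    qed
    then have "(\<integral>\<theta>. v (cis \<theta> * z) \<partial>angle_measure)
        = area z *\<^sub>R (u z * cnj (\<integral>\<theta>. H (cis \<theta> * z) * cis (- (real n * \<theta>)) \<partial>angle_measure))"
      by (simp add: integral_cnj[symmetric] del: complex_cnj_mult)
    also have "\<dots> = cnj (of_real (2 * pi) * (deriv ^^ n) H 0 / fact n) * (area z *\<^sub>R (u z * cnj (z ^ n)))"
      unfolding circle_integral_coeff_disc[OF H z] by (simp add: scaleR_conv_of_real mult_ac)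
    finally show "(\<integral>\<theta>. v (cis \<theta> * z) \<partial>angle_measure)
        = cnj (of_real (2 * pi) * (deriv ^^ n) H 0 / fact n) * (area z *\<^sub>R (u z * cnj (z ^ n)))" .
  qed
  also have "\<dots> = 0" by (simp only: integral_mult_right_zero zero mult_zero_right)
  finally show ?thesis .
qed

end

section \<open>The Szego projection on homogeneous functions of the first variable\<close>

lemma holomorphic_on_C2_lincomb:
  assumes "holomorphic_on_C2 g S" "holomorphic_on_C2 h S"
  shows "holomorphic_on_C2 (\<lambda>x. g x + c * h x) S"
  unfolding holomorphic_on_C2_def
proof
  fix z assume "z \<in> S"
  then obtain a b a' b' where
    d: "(g has_derivative (\<lambda>k. a * fst k + b * snd k)) (at z)"
       "(h has_derivative (\<lambda>k. a' * fst k + b' * snd k)) (at z)"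
    using assms by (auto simp: holomorphic_on_C2_def) blast
  have "((\<lambda>x. g x + c * h x) has_derivative
      (\<lambda>k. (a * fst k + b * snd k) + c * (a' * fst k + b' * snd k))) (at z)"
    by (intro derivative_intros d)
  also have "(\<lambda>k. (a * fst k + b * snd k) + c * (a' * fst k + b' * snd k))
      = (\<lambda>k. (a + c * a') * fst k + (b + c * b') * snd k)"
    by (auto simp: algebra_simps)
  finally show "\<exists>a b. ((\<lambda>x. g x + c * h x) has_derivative (\<lambda>k. a * fst k + b * snd k)) (at z)"
    by blast
qed

lemma holomorphic_on_C2_fst_power: "holomorphic_on_C2 (\<lambda>x. c * fst x ^ n) S"
  unfolding holomorphic_on_C2_def
proof
  fix z :: "complex \<times> complex"
  have "((\<lambda>x. c * fst x ^ n) has_derivative (\<lambda>k. (c * of_nat n * fst z ^ (n - 1)) * fst k + 0 * snd k)) (at z)"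
    by (auto intro!: derivative_eq_intros simp: mult_ac)
  then show "\<exists>a b. ((\<lambda>x. c * fst x ^ n) has_derivative (\<lambda>k. a * fst k + b * snd k)) (at z)"
    by blast
qed

theorem Szego_projection_bounded_L2: "bounded_on_Lp 2 M (Szego_projection S M)"
proof -
  have "bounded_on_Lp 2 M (orthogonal_projection M
      (Lp_closure 2 M {g. holomorphic_on_C2 g S \<and> continuous_on (closure S) g}))"
  proof (rule orthogonal_projection_bounded_L2)
    show "(\<lambda>x. 0) \<in> {g. holomorphic_on_C2 g S \<and> continuous_on (closure S) g}"
      using holomorphic_on_C2_fst_power[of 0 0 S] by simp
    fix g h :: "complex \<times> complex \<Rightarrow> complex" and c :: complex
    assume "g \<in> {g. holomorphic_on_C2 g S \<and> continuous_on (closure S) g}"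
      "h \<in> {g. holomorphic_on_C2 g S \<and> continuous_on (closure S) g}"
    then show "(\<lambda>x. g x + c * h x) \<in> {g. holomorphic_on_C2 g S \<and> continuous_on (closure S) g}"
      by (auto intro!: holomorphic_on_C2_lincomb continuous_intros)
  qed
  then show ?thesis by (simp add: Szego_projection_def[abs_def] Hardy_space_def)
qed

context circular_profile
begin

definition moment :: "real \<Rightarrow> real" where
  "moment s = (\<integral>z. area z * norm z powr s \<partial>disc_measure)"

lemma area_powr_integrable:
  assumes s: "s \<ge> 0"
  shows "integrable disc_measure (\<lambda>z. area z * norm z powr s)"
proof -
  interpret D: finite_measure disc_measure by (rule finite_measure_disc)
  obtain K where K: "\<And>z. z \<in> ball 0 1 \<Longrightarrow> area z \<le> K" using area_bounded by blast
  show ?thesis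
  proof (rule D.integrable_const_bound[of _ "K * 1"])
    have "norm (area z * norm z powr s) \<le> K * 1" if z: "z \<in> ball 0 1" for z
    proof -
      have "area z * norm z powr s \<le> area z * 1"
        using area_pos[OF z] s z by (intro mult_left_mono powr_le1) auto
      also have "\<dots> \<le> K * 1" using K[OF z] by simp
      finally show ?thesis using area_pos[OF z] by (simp add: abs_mult)
    qed
    then show "AE z in disc_measure. norm (area z * norm z powr s) \<le> K * 1"
      by (intro AE_I2) (simp add: space_restrict_space)
  qed measurable
qed

text \<open>The integrand vanishes at most at the origin, which is a null set.\<close>

lemma moment_pos:
  assumes s: "s \<ge> 0"
  shows "0 < moment s"
proof -
  have nn: "AE z in disc_measure. 0 \<le> area z * norm z powr s"
    by (rule AE_I2) (auto intro!: mult_nonneg_nonneg less_imp_le[OF area_pos] simp: space_restrict_space)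
  have "moment s \<noteq> 0"
  proof
    assume "moment s = 0"
    then have 0: "AE z in disc_measure. area z * norm z powr s = 0"
      using integral_nonneg_eq_0_iff_AE[OF area_powr_integrable[OF s] nn] by (simp add: moment_def)
    have "AE z in lborel. z \<noteq> (0::complex)" by (rule AE_lborel_singleton)
    then have "AE z in disc_measure. z \<noteq> 0" by (subst AE_restrict_space_iff) auto
    from AE_conjI[OF 0 this] have "AE z in disc_measure. False"
    proof (rule AE_mp)
      show "AE z in disc_measure. area z * norm z powr s = 0 \<and> z \<noteq> 0 \<longrightarrow> False"
      proof (rule AE_I2, rule impI)
        fix z assume "z \<in> space disc_measure" "area z * norm z powr s = 0 \<and> z \<noteq> 0"
        then show False using area_pos[of z] by (simp add: space_restrict_space)
      qed
    qed
    then obtain N where N: "{z \<in> space disc_measure. \<not> False} \<subseteq> N" "emeasure disc_measure N = 0" "N \<in> sets disc_measure"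
      by (rule AE_E)
    from N(1) have "space disc_measure \<subseteq> N" by blast
    from emeasure_mono[OF this N(3)] have "emeasure disc_measure (space disc_measure) = 0"
      using N(2) by (metis le_zero_eq)
    then have "emeasure lborel (ball (0::complex) 1) = 0"
      by (simp add: emeasure_restrict_space space_restrict_space)
    moreover have "measure lborel (ball (0::complex) 1) > 0" by (rule content_ball_pos) simp
    ultimately show False by (simp add: measure_def)
  qed
  moreover have "moment s \<ge> 0" unfolding moment_def by (rule integral_nonneg_AE[OF nn])
  ultimately show ?thesis by simp
qed

lemma fst_frontier: "x \<in> frontier \<Omega> \<Longrightarrow> norm (fst x) \<le> 1"
proof -
  assume "x \<in> frontier \<Omega>"
  then have "x \<in> closure \<Omega>" by (simp add: frontier_def)
  also have "\<dots> \<subseteq> closure (ball 0 1 \<times> UNIV)"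
    by (rule closure_mono) (auto simp: Hartogs_domain_def)
  finally show "norm (fst x) \<le> 1" by (auto simp: closure_Times)
qed

lemma fst_in_Lp_space:
  fixes u :: "complex \<Rightarrow> complex"
  assumes u[measurable]: "u \<in> borel_measurable borel" and bnd: "\<And>z. norm z \<le> 1 \<Longrightarrow> norm (u z) \<le> U"
    and r: "r \<ge> 0"
  shows "(\<lambda>x. u (fst x)) \<in> Lp_space r \<sigma>"
proof -
  interpret S: finite_measure \<sigma> by (rule finite_surface)
  have m[measurable]: "(\<lambda>x. u (fst x)) \<in> borel_measurable \<sigma>"
    using fst_measurable_frontier[OF u] by measurable
  have "integrable \<sigma> (\<lambda>x. norm (u (fst x)) powr r)"
  proof (rule S.integrable_const_bound[of _ "U powr r"])
    have "space \<sigma> = frontier \<Omega>" by (simp add: surface_measure_eq space_restrict_space)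
    then show "AE x in \<sigma>. norm (norm (u (fst x)) powr r) \<le> U powr r"
      using bnd fst_frontier r by (intro AE_I2) (auto intro!: powr_mono2)
  qed measurable
  then show ?thesis using m by (simp add: Lp_space_def)
qed

lemma Lp_norm_fst:
  fixes u :: "complex \<Rightarrow> complex"
  assumes u[measurable]: "u \<in> borel_measurable borel" and bnd: "\<And>z. norm z \<le> 1 \<Longrightarrow> norm (u z) \<le> U"
    and r: "r \<ge> 0"
  shows "Lp_norm r \<sigma> (\<lambda>x. u (fst x)) = (2 * pi * (\<integral>z. area z * norm (u z) powr r \<partial>disc_measure)) powr (1 / r)"
proof -
  have "(\<integral>x. norm (u (fst x)) powr r \<partial>\<sigma>) = (2 * pi) *\<^sub>R (\<integral>z. area z *\<^sub>R (norm (u z) powr r) \<partial>disc_measure)"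
  proof (rule integral_surface_fst[of "\<lambda>z. norm (u z) powr r" "U powr r"])
    show "norm (norm (u z) powr r) \<le> U powr r" if "z \<in> ball 0 1" for z
      using bnd[of z] that r by (auto intro!: powr_mono2)
  qed measurable
  then show ?thesis by (simp add: Lp_norm_def)
qed

text \<open>A function of the first variable with the rotational symmetry of \<open>z\<^sup>n\<close> is projected onto the line
  spanned by \<open>z\<^sup>n\<close>; the factor \<open>lam\<close> is fixed by requiring orthogonality to \<open>z\<^sup>n\<close> itself.\<close>

lemma Szego_fst_AE_eq:
  fixes u :: "complex \<Rightarrow> complex"
  assumes u[measurable]: "u \<in> borel_measurable borel" and bnd: "\<And>z. norm z \<le> 1 \<Longrightarrow> norm (u z) \<le> U"
    and hom: "\<And>c z. norm c = 1 \<Longrightarrow> u (c * z) = c ^ n * u z"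
    and lam: "(\<integral>z. area z *\<^sub>R (u z * cnj (z ^ n)) \<partial>disc_measure) = of_real (lam * moment (2 * real n))"
    and n: "n \<ge> 1"
  shows "AE x in \<sigma>. Szego_projection \<Omega> \<sigma> (\<lambda>x. u (fst x)) x = of_real lam * fst x ^ n"
proof -
  interpret D: finite_measure disc_measure by (rule finite_measure_disc)
  define F where "F = {g. holomorphic_on_C2 g \<Omega> \<and> continuous_on (closure \<Omega>) g}"
  have Hardy: "Hardy_space 2 \<Omega> \<sigma> = Lp_closure 2 \<sigma> F" by (simp add: Hardy_space_def F_def)
  have u_L2: "(\<lambda>x. u (fst x)) \<in> Lp_space 2 \<sigma>" by (rule fst_in_Lp_space[OF u bnd]) auto
  have pow_meas[measurable]: "(\<lambda>z::complex. z ^ n) \<in> borel_measurable borel" by measurable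
  have pow_bnd: "norm (of_real lam * z ^ n) \<le> \<bar>lam\<bar>" if "norm z \<le> 1" for z :: complex
    using that power_le_one[of "norm z" n] by (simp add: norm_mult norm_power mult_left_le)
  have g_L2: "(\<lambda>x. of_real lam * fst x ^ n) \<in> Lp_space 2 \<sigma>"
    by (rule fst_in_Lp_space[where u = "\<lambda>z. of_real lam * z ^ n", OF _ pow_bnd]) auto
  have g_F: "(\<lambda>x. of_real lam * fst x ^ n) \<in> F"
    by (auto simp: F_def intro!: holomorphic_on_C2_fst_power continuous_intros)
  have g_H: "(\<lambda>x. of_real lam * fst x ^ n) \<in> Lp_closure 2 \<sigma> F"
    unfolding Lp_closure_def using g_L2 g_F
    by (auto simp: Lp_norm_def intro!: bexI[of _ "\<lambda>x. of_real lam * fst x ^ n"])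
  obtain K where K: "\<And>z. z \<in> ball 0 1 \<Longrightarrow> area z \<le> K" using area_bounded by blast
  have K0: "K \<ge> 0" using K[of 0] area_pos[of 0] by simp
  have [measurable]: "u \<in> borel_measurable disc_measure" "(\<lambda>z::complex. z ^ n) \<in> borel_measurable disc_measure"
    by (simp_all add: measurable_restrict_space1)
  have int_u: "integrable disc_measure (\<lambda>z. area z *\<^sub>R (u z * cnj (z ^ n)))"
  proof (rule D.integrable_const_bound[of _ "K * (U * 1)"])
    have "norm (area z *\<^sub>R (u z * cnj (z ^ n))) \<le> K * (U * 1)" if z: "z \<in> ball 0 1" for z
    proof -
      have "norm (u z) \<le> U" "norm (z ^ n) \<le> 1" using z bnd[of z] power_le_one[of "norm z" n] by (auto simp: norm_power)
      moreover have "0 \<le> U" using calculation(1) norm_ge_zero order_trans by blast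
      ultimately have "norm (u z) * norm (z ^ n) \<le> U * 1" by (intro mult_mono) auto
      then have "area z * (norm (u z) * norm (z ^ n)) \<le> K * (U * 1)"
        by (intro mult_mono[OF K[OF z] _ K0]) auto
      then show ?thesis using area_pos[OF z] by (simp add: norm_mult del: complex_cnj_power)
    qed
    then show "AE z in disc_measure. norm (area z *\<^sub>R (u z * cnj (z ^ n))) \<le> K * (U * 1)"
      by (intro AE_I2) (simp add: space_restrict_space)
  qed measurable
  have sq: "area z *\<^sub>R (of_real lam * z ^ n * cnj (z ^ n)) = of_real (lam * (area z * norm z powr (2 * real n)))" for z
  proof (cases "z = 0")
    case False
    have "z ^ n * cnj (z ^ n) = of_real ((norm (z ^ n))\<^sup>2)" by (simp only: complex_norm_square)
    also have "(norm (z ^ n))\<^sup>2 = norm z powr (2 * real n)"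
      using False by (simp add: norm_power powr_realpow[symmetric] powr_powr power_mult[symmetric] mult.commute)
    finally show ?thesis by (simp add: scaleR_conv_of_real mult_ac)
  qed (use n in simp)
  have int_g: "integrable disc_measure (\<lambda>z. area z *\<^sub>R (of_real lam * z ^ n * cnj (z ^ n)))"
    unfolding sq by (intro integrable_of_real integrable_mult_right area_powr_integrable) auto
  have "(\<integral>z. area z *\<^sub>R ((u z - of_real lam * z ^ n) * cnj (z ^ n)) \<partial>disc_measure)
      = (\<integral>z. area z *\<^sub>R (u z * cnj (z ^ n)) - area z *\<^sub>R (of_real lam * z ^ n * cnj (z ^ n)) \<partial>disc_measure)"
    by (simp only: left_diff_distrib scaleR_diff_right)
  also have "\<dots> = (\<integral>z. area z *\<^sub>R (u z * cnj (z ^ n)) \<partial>disc_measure)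
      - (\<integral>z. area z *\<^sub>R (of_real lam * z ^ n * cnj (z ^ n)) \<partial>disc_measure)"
    by (rule Bochner_Integration.integral_diff[OF int_u int_g])
  also have "\<dots> = 0"
    unfolding sq lam by (simp only: integral_complex_of_real integral_mult_right_zero moment_def) simp
  finally have zero: "(\<integral>z. area z *\<^sub>R ((u z - of_real lam * z ^ n) * cnj (z ^ n)) \<partial>disc_measure) = 0" .
  have orth: "L2_inner \<sigma> (\<lambda>x. u (fst x) - of_real lam * fst x ^ n) h = 0" if h: "h \<in> Lp_closure 2 \<sigma> F" for h
  proof (rule orthogonal_to_closure[OF L2_diff[OF u_L2 g_L2] h])
    fix k assume "k \<in> F \<inter> Lp_space 2 \<sigma>"
    then have k: "holomorphic_on_C2 k \<Omega>" "continuous_on (closure \<Omega>) k" by (auto simp: F_def)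
    show "L2_inner \<sigma> (\<lambda>x. u (fst x) - of_real lam * fst x ^ n) k = 0"
    proof (rule fst_L2_inner_holomorphic_eq_0[where u = "\<lambda>z. u z - of_real lam * z ^ n" and U = "U + \<bar>lam\<bar>", OF _ _ _ zero k])
      fix z :: complex assume "z \<in> ball 0 1"
      then show "norm (u z - of_real lam * z ^ n) \<le> U + \<bar>lam\<bar>"
        using norm_triangle_ineq4[of "u z" "of_real lam * z ^ n"] bnd[of z] pow_bnd[of z] by simp
    next
      fix c z :: complex assume "norm c = 1"
      then show "u (c * z) - of_real lam * (c * z) ^ n = c ^ n * (u z - of_real lam * z ^ n)"
        by (simp add: hom power_mult_distrib algebra_simps)
    qed measurable
  qed
  show ?thesis
    unfolding Szego_projection_def Hardy
    by (rule orthogonal_projection_AE_eq[OF u_L2 _ g_H orth]) (auto simp: Lp_closure_def)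
qed

text \<open>The norm of the rank one operator \<open>f \<mapsto> \<langle>f, z\<^sup>n\<rangle> z\<^sup>n / \<parallel>z\<^sup>n\<parallel>\<^sup>2\<close> on \<open>L\<^sup>p\<close> is the product of the norms of \<open>z\<^sup>n\<close>
  in \<open>L\<^sup>p\<close> and in the dual space \<open>L\<^sup>q\<close>, divided by the square of its norm in \<open>L\<^sup>2\<close>. A bounded projection
  therefore bounds these quotients uniformly in \<open>n\<close>.\<close>

theorem Szego_bounded_imp_moment_inequality:
  assumes p: "p > 1" and q: "q = p / (p - 1)"
    and bounded: "bounded_on_Lp p \<sigma> (Szego_projection \<Omega> \<sigma>)"
  shows "\<exists>C>0. \<forall>n\<ge>1. moment (real n * p) powr (1 / p) * moment (real n * q) powr (1 / q) \<le> C * moment (2 * real n)"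
proof -
  obtain C where C: "C > 0" and le: "\<And>f. f \<in> Lp_space 2 \<sigma> \<inter> Lp_space p \<sigma> \<Longrightarrow>
      Szego_projection \<Omega> \<sigma> f \<in> Lp_space p \<sigma> \<and>
      Lp_norm p \<sigma> (Szego_projection \<Omega> \<sigma> f) \<le> C * Lp_norm p \<sigma> f"
    using bounded by (auto simp: bounded_on_Lp_def)
  have q1: "q > 1" using p unfolding q by (simp add: field_simps)
  have qp: "(q - 1) * p = q" "1 - 1 / p = 1 / q" using p unfolding q by (simp_all add: field_simps)
  have "moment (real n * p) powr (1 / p) * moment (real n * q) powr (1 / q) \<le> C * moment (2 * real n)"
    if n: "n \<ge> 1" for n
  proof -
    \<comment> \<open>The extremal function in Hoelder's inequality for the pairing with \<open>z\<^sup>n\<close>. It is homogeneous like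
        \<open>z\<^sup>n\<close>, and the division by zero at the origin is harmless because \<open>n \<ge> 1\<close>.\<close>
    define u where "u z = (z / of_real (norm z)) ^ n * of_real (norm z powr (real n * (q - 1)))" for z :: complex
    have u[measurable]: "u \<in> borel_measurable borel" unfolding u_def by measurable
    have norm_u: "norm (u z) = norm z powr (real n * (q - 1))" for z
      using n by (cases "z = 0") (auto simp: u_def norm_mult norm_power norm_divide)
    have u_bnd: "norm (u z) \<le> 1" if "norm z \<le> 1" for z
      unfolding norm_u using that q1 by (intro powr_le1) auto
    have hom: "u (c * z) = c ^ n * u z" if "norm c = 1" for c z
      using that by (simp add: u_def norm_mult power_mult_distrib power_divide)
    have u_pow: "u z * cnj (z ^ n) = of_real (norm z powr (real n * q))" for z
    proof (cases "z = 0")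
      case False
      have "(z / of_real (norm z)) ^ n * cnj (z ^ n) = (z * cnj z / of_real (norm z)) ^ n"
        by (simp add: power_mult_distrib power_divide)
      also have "z * cnj z / of_real (norm z) = of_real (norm z)"
        using False by (simp flip: complex_norm_square add: power2_eq_square)
      finally have "(z / of_real (norm z)) ^ n * cnj (z ^ n) = of_real (norm z powr real n)"
        using False by (simp add: powr_realpow)
      then have "u z * cnj (z ^ n) = of_real (norm z powr real n * norm z powr (real n * (q - 1)))"
        by (simp add: u_def mult_ac)
      also have "norm z powr real n * norm z powr (real n * (q - 1)) = norm z powr (real n * q)"
        by (simp add: powr_add[symmetric] algebra_simps)
      finally show ?thesis .
    qed (use n in simp)
    define lam where "lam = moment (real n * q) / moment (2 * real n)"
    have m: "moment (real n * q) > 0" "moment (real n * p) > 0" "moment (2 * real n) > 0"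
      using p q1 by (auto intro!: moment_pos)
    have lam_pos: "lam > 0" using m by (simp add: lam_def)
    have lam: "(\<integral>z. area z *\<^sub>R (u z * cnj (z ^ n)) \<partial>disc_measure) = of_real (lam * moment (2 * real n))"
    proof -
      have "(\<integral>z. area z *\<^sub>R (u z * cnj (z ^ n)) \<partial>disc_measure)
          = (\<integral>z. complex_of_real (area z * norm z powr (real n * q)) \<partial>disc_measure)"
        by (simp only: u_pow scaleR_conv_of_real of_real_mult)
      also have "\<dots> = of_real (moment (real n * q))"
        by (simp only: integral_complex_of_real moment_def)
      finally show ?thesis using m by (simp add: lam_def)
    qed
    have pow_bnd: "norm (of_real lam * z ^ n) \<le> \<bar>lam\<bar>" if "norm z \<le> 1" for z :: complex
      using that power_le_one[of "norm z" n] by (simp add: norm_mult norm_power mult_left_le)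
    define f where "f = (\<lambda>x::complex \<times> complex. u (fst x))"
    define T where "T = Szego_projection \<Omega> \<sigma> f"
    have "f \<in> Lp_space 2 \<sigma> \<inter> Lp_space p \<sigma>"
      unfolding f_def using p by (auto intro!: fst_in_Lp_space[OF u u_bnd])
    from le[OF this] have T: "T \<in> Lp_space p \<sigma>" "Lp_norm p \<sigma> T \<le> C * Lp_norm p \<sigma> f"
      unfolding T_def by auto
    have f_norm: "Lp_norm p \<sigma> f = (2 * pi * moment (real n * q)) powr (1 / p)"
    proof -
      have "norm (u z) powr p = norm z powr (real n * q)" for z
        unfolding norm_u powr_powr mult.assoc qp ..
      then show ?thesis
        unfolding f_def moment_def using p by (subst Lp_norm_fst[OF u u_bnd]) auto
    qed
    have "AE x in \<sigma>. T x = of_real lam * fst x ^ n"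
      unfolding T_def f_def by (rule Szego_fst_AE_eq[OF u u_bnd hom lam n])
    moreover have [measurable]: "(\<lambda>x. of_real lam * fst x ^ n) \<in> borel_measurable \<sigma>"
      using fst_in_Lp_space[where u = "\<lambda>z. of_real lam * z ^ n" and r = 1, OF _ pow_bnd] by (auto simp: Lp_space_def)
    moreover have [measurable]: "T \<in> borel_measurable \<sigma>" using T(1) by (simp add: Lp_space_def)
    ultimately have "(\<integral>x. norm (T x) powr p \<partial>\<sigma>) = (\<integral>x. norm (of_real lam * fst x ^ n) powr p \<partial>\<sigma>)"
      by (intro integral_cong_AE) (measurable, auto)
    then have "Lp_norm p \<sigma> T = Lp_norm p \<sigma> (\<lambda>x. of_real lam * fst x ^ n)"
      by (simp add: Lp_norm_def)
    also have "\<dots> = (2 * pi * (\<integral>z. area z * norm (of_real lam * z ^ n) powr p \<partial>disc_measure)) powr (1 / p)"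
      by (rule Lp_norm_fst[where u = "\<lambda>z. of_real lam * z ^ n", OF _ pow_bnd]) (use p in auto)
    also have "(\<lambda>z::complex. area z * norm (of_real lam * z ^ n) powr p)
        = (\<lambda>z. lam powr p * (area z * norm z powr (real n * p)))"
    proof
      fix z :: complex
      have "norm (z ^ n) powr p = norm z powr (real n * p)"
        using n by (cases "z = 0") (simp_all add: norm_power powr_realpow[symmetric] powr_powr)
      then show "area z * norm (of_real lam * z ^ n) powr p = lam powr p * (area z * norm z powr (real n * p))"
        using lam_pos by (simp add: norm_mult powr_mult)
    qed
    finally have "Lp_norm p \<sigma> T = (2 * pi * (lam powr p * moment (real n * p))) powr (1 / p)"
      by (simp only: integral_mult_right_zero moment_def)
    also have "\<dots> = (2 * pi) powr (1 / p) * (lam * moment (real n * p) powr (1 / p))"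
      using p m lam_pos by (simp add: powr_mult powr_powr)
    finally have "(2 * pi) powr (1 / p) * (lam * moment (real n * p) powr (1 / p))
        \<le> C * ((2 * pi) powr (1 / p) * moment (real n * q) powr (1 / p))"
      using T(2) m by (simp add: f_norm powr_mult)
    then have *: "lam * moment (real n * p) powr (1 / p) \<le> C * moment (real n * q) powr (1 / p)"
      by (simp add: mult.left_commute[of C])
    have split: "moment (real n * q) = moment (real n * q) powr (1 / q) * moment (real n * q) powr (1 / p)"
      using m by (simp add: powr_add[symmetric] qp(2)[symmetric])
    have "moment (real n * q) powr (1 / p) * (moment (real n * p) powr (1 / p) * moment (real n * q) powr (1 / q))
        = moment (real n * q) * moment (real n * p) powr (1 / p)"
      by (subst (2) split) (simp add: mult_ac)
    also have "\<dots> = (lam * moment (real n * p) powr (1 / p)) * moment (2 * real n)"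
      using m by (simp add: lam_def)
    also have "\<dots> \<le> (C * moment (real n * q) powr (1 / p)) * moment (2 * real n)"
      using * m by (intro mult_right_mono) auto
    also have "\<dots> = moment (real n * q) powr (1 / p) * (C * moment (2 * real n))" by simp
    finally show ?thesis using m by (simp add: mult_le_cancel_left_pos)
  qed
  then show ?thesis using C by blast
qed

end

section \<open>The exponential profile\<close>

text \<open>In the variable \<open>y = s powr (- \<alpha>)\<close> this says that the exponential beats every power.\<close>

lemma powr_exp_neg_bounded:
  fixes B \<alpha> k :: real
  assumes B: "B > 0" and \<alpha>: "\<alpha> > 0"
  shows "\<exists>K. \<forall>s. 0 < s \<and> s \<le> 1 \<longrightarrow> s powr (- k) * exp (- B / s powr \<alpha>) \<le> K"
proof -
  define N where "N = Suc (nat \<lceil>k / \<alpha>\<rceil>)"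
  have N: "N > 0" "k / \<alpha> \<le> real N" unfolding N_def by linarith+
  have "s powr (- k) * exp (- B / s powr \<alpha>) \<le> (real N / B) ^ N" if s: "0 < s" "s \<le> 1" for s
  proof -
    define y where "y = s powr (- \<alpha>)"
    have y: "y \<ge> 1" unfolding y_def using s \<alpha> by (simp add: powr_minus one_le_inverse powr_le1)
    have "s powr (- k) = y powr (k / \<alpha>)" using \<alpha> by (simp add: y_def powr_powr)
    also have "\<dots> \<le> y powr real N" using y N by (intro powr_mono) auto
    also have "\<dots> = y ^ N" using y by (simp add: powr_realpow)
    finally have 1: "s powr (- k) \<le> y ^ N" .
    have "(B * y / real N) ^ N \<le> (1 + B * y / real N) ^ N"
      using B y by (intro power_mono) auto
    also have "\<dots> \<le> exp (B * y)"
      using B y N by (intro exp_ge_one_plus_x_over_n_power_n) (auto intro: order_trans[of _ 0])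
    finally have "y ^ N \<le> (real N / B) ^ N * exp (B * y)"
      using B N by (simp add: power_divide power_mult_distrib field_simps)
    with 1 have "s powr (- k) \<le> (real N / B) ^ N * exp (B * y)" by linarith
    then have "s powr (- k) * exp (- (B * y)) \<le> (real N / B) ^ N * exp (B * y) * exp (- (B * y))"
      by (intro mult_right_mono) auto
    also have "\<dots> = (real N / B) ^ N" by (simp add: mult.assoc exp_add[symmetric])
    finally show ?thesis by (simp add: y_def powr_minus divide_inverse)
  qed
  then show ?thesis by blast
qed

lemma gradient_eqI:
  assumes "GDERIV f z :> D"
  shows "gradient f z = D"
  unfolding gradient_def
proof (rule the_equality[of "\<lambda>D. GDERIV f z :> D", OF assms])
  fix E assume "GDERIV f z :> E"
  then have "(\<lambda>h. h \<bullet> E) = (\<lambda>h. h \<bullet> D)"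
    using assms unfolding gderiv_def by (rule has_derivative_unique)
  then have "(E - D) \<bullet> E = (E - D) \<bullet> D" by metis
  then have "(E - D) \<bullet> (E - D) = 0" by (simp only: inner_diff_right)
  then show "E = D" by simp
qed

locale exp_profile_domain =
  fixes A B \<alpha> :: real
  assumes A: "A \<ge> 0" and B: "B > 0" and \<alpha>: "\<alpha> > 0"
begin

text \<open>The profile is a function of \<open>s = 1 - \<bar>z\<bar>\<^sup>2\<close>, and this is its derivative in \<open>s\<close>.\<close>

definition slope :: "real \<Rightarrow> real" where
  "slope s = exp (- B / s powr \<alpha>) * (A * s powr (A - 1) + B * \<alpha> * s powr (A - \<alpha> - 1))"

lemma has_slope:
  assumes "s > 0"
  shows "((\<lambda>s. s powr A * exp (- B / s powr \<alpha>)) has_real_derivative slope s) (at s)"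
proof -
  have "((\<lambda>s. s powr A * exp (- B * s powr (- \<alpha>))) has_real_derivative
      s powr A * (exp (- B * s powr (- \<alpha>)) * (- B * (- \<alpha> * s powr (- \<alpha> - 1))))
      + A * s powr (A - 1) * exp (- B * s powr (- \<alpha>))) (at s)"
    using assms by (auto intro!: derivative_eq_intros)
  also have "s powr A * (exp (- B * s powr (- \<alpha>)) * (- B * (- \<alpha> * s powr (- \<alpha> - 1))))
      + A * s powr (A - 1) * exp (- B * s powr (- \<alpha>)) = slope s"
    using assms by (simp add: slope_def powr_minus powr_diff powr_add divide_inverse algebra_simps)
  finally show ?thesis by (simp add: powr_minus divide_inverse)
qed

lemma norm_sq_less_1: "z \<in> ball 0 1 \<Longrightarrow> 1 - (norm z)\<^sup>2 > 0" for z :: complex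
  by (simp add: power_less_one_iff abs_square_less_1)

lemma gradient_exp_profile:
  assumes z: "z \<in> ball 0 1"
  shows "gradient (exp_profile A B \<alpha>) z = (- 2 * slope (1 - (norm z)\<^sup>2)) *\<^sub>R z"
proof (rule gradient_eqI)
  have d: "((\<lambda>z. 1 - z \<bullet> z) has_derivative (\<lambda>h. - 2 * (h \<bullet> z))) (at z)"
    by (auto intro!: derivative_eq_intros simp: inner_commute)
  have "((\<lambda>s. s powr A * exp (- B / s powr \<alpha>)) has_derivative (*) (slope (1 - z \<bullet> z))) (at (1 - z \<bullet> z))"
    using has_slope[of "1 - z \<bullet> z"] norm_sq_less_1[OF z]
    by (simp add: has_field_derivative_def power2_norm_eq_inner)
  from has_derivative_compose[OF d this]
  show "GDERIV (exp_profile A B \<alpha>) z :> (- 2 * slope (1 - (norm z)\<^sup>2)) *\<^sub>R z"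
    by (simp add: gderiv_def exp_profile_def[abs_def] power2_norm_eq_inner mult_ac)
qed

lemma area_factor_exp_profile:
  assumes z: "z \<in> ball 0 1"
  shows "area_factor (exp_profile A B \<alpha>) z
    = exp_profile A B \<alpha> z * sqrt (1 + (2 * slope (1 - (norm z)\<^sup>2) * norm z)\<^sup>2)"
  unfolding area_factor_def gradient_exp_profile[OF z] by (simp add: power_mult_distrib)

text \<open>The exponential decay of the profile outweighs the negative powers of \<open>1 - \<bar>z\<bar>\<^sup>2\<close> in its gradient, so
  the surface density is comparable to the profile itself.\<close>

lemma area_factor_le: "\<exists>K>0. \<forall>z\<in>ball 0 1. area_factor (exp_profile A B \<alpha>) z \<le> K * exp_profile A B \<alpha> z"
proof -
  obtain K1 where K1: "\<And>s. 0 < s \<Longrightarrow> s \<le> 1 \<Longrightarrow> s powr (- 1) * exp (- B / s powr \<alpha>) \<le> K1"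
    using powr_exp_neg_bounded[OF B \<alpha>, of 1] by blast
  obtain K2 where K2: "\<And>s. 0 < s \<Longrightarrow> s \<le> 1 \<Longrightarrow> s powr (- (\<alpha> + 1)) * exp (- B / s powr \<alpha>) \<le> K2"
    using powr_exp_neg_bounded[OF B \<alpha>, of "\<alpha> + 1"] by blast
  define K where "K = A * K1 + B * \<alpha> * K2"
  have slope0: "0 \<le> slope s" for s unfolding slope_def using A B \<alpha> by simp
  have slopeK: "slope s \<le> K" if s: "0 < s" "s \<le> 1" for s
  proof -
    have "s powr (A - 1) * exp (- B / s powr \<alpha>) \<le> s powr (- 1) * exp (- B / s powr \<alpha>)"
      using A s by (intro mult_right_mono powr_mono') auto
    from order_trans[OF this K1[OF s]]
    have 1: "A * (s powr (A - 1) * exp (- B / s powr \<alpha>)) \<le> A * K1"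
      using A by (rule mult_left_mono)
    have "s powr (A - \<alpha> - 1) * exp (- B / s powr \<alpha>) \<le> s powr (- (\<alpha> + 1)) * exp (- B / s powr \<alpha>)"
      using A s by (intro mult_right_mono powr_mono') auto
    from order_trans[OF this K2[OF s]]
    have 2: "B * \<alpha> * (s powr (A - \<alpha> - 1) * exp (- B / s powr \<alpha>)) \<le> B * \<alpha> * K2"
      by (rule mult_left_mono) (use B \<alpha> in simp)
    show ?thesis using 1 2 by (simp add: slope_def K_def algebra_simps)
  qed
  have K0: "0 \<le> K" using order_trans[OF slope0 slopeK[of 1]] by simp
  have "area_factor (exp_profile A B \<alpha>) z \<le> sqrt (1 + (2 * K * 1)\<^sup>2) * exp_profile A B \<alpha> z"
    if z: "z \<in> ball 0 1" for z
  proof -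
    have "2 * slope (1 - (norm z)\<^sup>2) * norm z \<le> 2 * K * 1"
      using slope0 slopeK[OF norm_sq_less_1[OF z]] z K0 by (intro mult_mono) auto
    then have "sqrt (1 + (2 * slope (1 - (norm z)\<^sup>2) * norm z)\<^sup>2) \<le> sqrt (1 + (2 * K * 1)\<^sup>2)"
      using slope0 by (intro real_sqrt_le_mono add_left_mono power_mono) auto
    then have "exp_profile A B \<alpha> z * sqrt (1 + (2 * slope (1 - (norm z)\<^sup>2) * norm z)\<^sup>2)
        \<le> exp_profile A B \<alpha> z * sqrt (1 + (2 * K * 1)\<^sup>2)"
      by (intro mult_left_mono) (auto simp: exp_profile_def)
    then show ?thesis unfolding area_factor_exp_profile[OF z] by (simp add: mult.commute)
  qed
  moreover have "sqrt (1 + (2 * K * 1)\<^sup>2) > 0" by (simp add: add_pos_nonneg)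
  ultimately show ?thesis by blast
qed

lemma exp_profile_le_exp:
  assumes z: "z \<in> ball 0 1"
  shows "exp_profile A B \<alpha> z \<le> exp (- B / (1 - (norm z)\<^sup>2) powr \<alpha>)"
proof -
  have "(1 - (norm z)\<^sup>2) powr A \<le> 1" using norm_sq_less_1[OF z] A by (intro powr_le1) auto
  then show ?thesis unfolding exp_profile_def by (simp add: mult_left_le_one_le)
qed

sublocale circular_profile "exp_profile A B \<alpha>"
proof
  show "0 < exp_profile A B \<alpha> z" if "z \<in> ball 0 1" for z
    using norm_sq_less_1[OF that] by (simp add: exp_profile_def)
  show c: "continuous_on (ball 0 1) (exp_profile A B \<alpha>)"
    unfolding exp_profile_def[abs_def] using norm_sq_less_1 by (force intro!: continuous_intros)
  have "continuous_on (ball 0 1) (\<lambda>z::complex. slope (1 - (norm z)\<^sup>2))"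
    unfolding slope_def using norm_sq_less_1 by (force intro!: continuous_intros)
  then have "continuous_on (ball 0 1) (\<lambda>z. exp_profile A B \<alpha> z * sqrt (1 + (2 * slope (1 - (norm z)\<^sup>2) * norm z)\<^sup>2))"
    using c by (intro continuous_intros)
  then show "continuous_on (ball 0 1) (area_factor (exp_profile A B \<alpha>))"
    by (rule continuous_on_eq) (simp add: area_factor_exp_profile)
  obtain K where K: "K > 0" "\<And>z. z \<in> ball 0 1 \<Longrightarrow> area_factor (exp_profile A B \<alpha>) z \<le> K * exp_profile A B \<alpha> z"
    using area_factor_le by blast
  have "area_factor (exp_profile A B \<alpha>) z \<le> K * 1" if z: "z \<in> ball 0 1" for z
  proof -
    have "exp (- B / (1 - (norm z)\<^sup>2) powr \<alpha>) \<le> 1" using B by simp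
    then have "exp_profile A B \<alpha> z \<le> 1" using exp_profile_le_exp[OF z] by linarith
    then have "K * exp_profile A B \<alpha> z \<le> K * 1" using K(1) by (intro mult_left_mono) auto
    then show ?thesis using K(2)[OF z] by linarith
  qed
  then show "\<exists>K. \<forall>z\<in>ball 0 1. area_factor (exp_profile A B \<alpha>) z \<le> K" by blast
  show "area_factor (exp_profile A B \<alpha>) (c * z) = area_factor (exp_profile A B \<alpha>) z"
    if "norm c = 1" "z \<in> ball 0 1" for c z
  proof -
    have "c * z \<in> ball 0 1" using that by (simp add: norm_mult)
    then show ?thesis using that by (simp only: area_factor_exp_profile) (simp add: exp_profile_def norm_mult)
  qed
qed

end

section \<open>Asymptotics of the moments of the exponential profile\<close>

text \<open>Strictness comes from applying the weak inequality to the square root of \<open>x\<close> and squaring.\<close>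

lemma powr_strict_Bernoulli:
  fixes x \<gamma> :: real
  assumes x: "x > 0" "x \<noteq> 1" and \<gamma>: "0 < \<gamma>" "\<gamma> < 1"
  shows "x powr \<gamma> < 1 + \<gamma> * (x - 1)"
proof -
  define y where "y = sqrt x"
  have y: "y > 0" "y \<noteq> 1" "x = y\<^sup>2" using x by (auto simp: y_def)
  have "y powr \<gamma> \<le> 1 + \<gamma> * (y - 1)"
    using Youngs_inequality_0[of \<gamma> "1 - \<gamma>" y 1] \<gamma> y by (simp add: algebra_simps)
  then have "(y powr \<gamma>)\<^sup>2 \<le> (1 + \<gamma> * (y - 1))\<^sup>2" by (intro power_mono) auto
  also have "\<dots> = 1 + \<gamma> * (2 * (y - 1)) + \<gamma> * (\<gamma> * (y - 1)\<^sup>2)"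
    by (simp add: power2_eq_square algebra_simps)
  also have "\<dots> < 1 + \<gamma> * (2 * (y - 1)) + \<gamma> * (1 * (y - 1)\<^sup>2)"
    using \<gamma> y by (intro add_strict_left_mono mult_strict_left_mono mult_strict_right_mono) auto
  also have "\<dots> = 1 + \<gamma> * (x - 1)" unfolding y(3) by (simp add: power2_eq_square algebra_simps)
  also have "(y powr \<gamma>)\<^sup>2 = x powr \<gamma>"
    unfolding y(3) using y by (simp add: powr_powr power2_eq_square powr_mult)
  finally show ?thesis .
qed

text \<open>The Bernoulli bounds are the tangents at \<open>1/2\<close> of the concave function \<open>\<lambda>x. x powr \<gamma>\<close>.\<close>

lemma powr_sum_less:
  fixes u v \<gamma> :: real
  assumes uv: "u > 0" "v > 0" "u + v = 1" "u \<noteq> v" and \<gamma>: "0 < \<gamma>" "\<gamma> < 1"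
  shows "u powr \<gamma> + v powr \<gamma> < 2 powr (1 - \<gamma>)"
proof -
  have "(2 * u) powr \<gamma> < 1 + \<gamma> * (2 * u - 1)" "(2 * v) powr \<gamma> < 1 + \<gamma> * (2 * v - 1)"
    using uv by (auto intro!: powr_strict_Bernoulli \<gamma>)
  then have "(2 * u) powr \<gamma> + (2 * v) powr \<gamma> < 2 + \<gamma> * (2 * (u + v) - 2)"
    by (simp add: algebra_simps)
  then have "2 powr \<gamma> * (u powr \<gamma> + v powr \<gamma>) < 2"
    using uv by (simp add: powr_mult algebra_simps)
  then show ?thesis by (simp add: powr_diff field_simps)
qed

context exp_profile_domain
begin

text \<open>The moment of order \<open>s\<close> behaves like the maximum over \<open>t = 1 - \<bar>z\<bar>\<^sup>2\<close> of \<open>exp (- t s / 2 - B t powr (- \<alpha>))\<close>. The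
  substitution \<open>t = a s powr (- 1 / (1 + \<alpha>))\<close> balances both terms: the exponent becomes
  \<open>- rate_at a * s powr growth\<close>, and \<open>rate\<close> is the optimal constant.\<close>

definition growth :: real where "growth = \<alpha> / (1 + \<alpha>)"

definition rate_at :: "real \<Rightarrow> real" where "rate_at a = a / 2 + B * a powr (- \<alpha>)"

definition rate :: real where "rate = (INF a\<in>{0<..}. rate_at a)"

lemma growth_bounds: "0 < growth" "growth < 1"
  using \<alpha> by (auto simp: growth_def field_simps)

lemma rate_at_ge: "a > 0 \<Longrightarrow> min (1 / 2) B \<le> rate_at a"
proof (cases "a \<le> 1")
  case True
  assume a: "a > 0"
  have "1 \<le> a powr (- \<alpha>)" using a True \<alpha> by (simp add: powr_minus one_le_inverse powr_le1)
  then have "B * 1 \<le> B * a powr (- \<alpha>)" using B by (intro mult_left_mono) auto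
  then show ?thesis using a by (simp add: rate_at_def min_def)
next
  case False
  then have "1 / 2 \<le> a / 2" by simp
  moreover have "0 \<le> B * a powr (- \<alpha>)" using B by simp
  ultimately show ?thesis unfolding rate_at_def by linarith
qed

lemma rate_pos: "rate > 0"
proof -
  have "min (1 / 2) B \<le> rate"
    unfolding rate_def by (rule cINF_greatest) (use rate_at_ge in auto)
  then show ?thesis using B by (simp add: min_def split: if_splits)
qed

lemma rate_le: "a > 0 \<Longrightarrow> rate \<le> rate_at a"
  unfolding rate_def by (rule cINF_lower[OF bdd_belowI2[of _ "min (1 / 2) B"]]) (use rate_at_ge in auto)

text \<open>The bound holds pointwise for the integrand, since \<open>1 - t \<le> exp (- t)\<close>.\<close>

lemma moment_upper: "\<exists>K>0. \<forall>s>0. moment s \<le> K * exp (- rate * s powr growth)"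
proof -
  interpret D: finite_measure disc_measure by (rule finite_measure_disc)
  obtain K where K: "K > 0" "\<And>z. z \<in> ball 0 1 \<Longrightarrow> area z \<le> K * exp_profile A B \<alpha> z"
    using area_factor_le by blast
  define D where "D = measure disc_measure (space disc_measure)"
  have "moment s \<le> (K * (D + 1)) * exp (- rate * s powr growth)" if s: "s > 0" for s
  proof -
    have pt: "area z * norm z powr s \<le> K * exp (- rate * s powr growth)" if z: "z \<in> ball 0 1" for z
    proof -
      define t where "t = 1 - (norm z)\<^sup>2"
      have t: "0 < t" "t \<le> 1" using norm_sq_less_1[OF z] by (auto simp: t_def)
      have "norm z powr s = ((norm z)\<^sup>2) powr (s / 2)"
        by (cases "z = 0") (simp_all add: powr_powr flip: powr_numeral)
      also have "\<dots> \<le> (exp (- t)) powr (s / 2)"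
        using s t exp_ge_add_one_self[of "- t"] by (intro powr_mono2) (auto simp: t_def)
      also have "\<dots> = exp (- (t * s / 2))" by (simp add: powr_def)
      finally have 1: "norm z powr s \<le> exp (- (t * s / 2))" .
      have 2: "exp_profile A B \<alpha> z \<le> exp (- B * t powr (- \<alpha>))"
        using exp_profile_le_exp[OF z] by (simp add: t_def powr_minus divide_inverse)
      \<comment> \<open>The scale at which the exponent at \<open>z\<close> is \<open>rate_at a * s powr growth\<close>.\<close>
      define a where "a = t * s powr (1 / (1 + \<alpha>))"
      have a: "a > 0" using t s by (simp add: a_def)
      have "rate_at a * s powr growth = t * s / 2 + B * t powr (- \<alpha>)"
      proof -
        have "1 / (1 + \<alpha>) + growth = 1" using \<alpha> by (simp add: growth_def field_simps)
        then have "a * s powr growth = t * s"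
          using s by (simp add: a_def mult.assoc powr_add[symmetric])
        moreover have "a powr (- \<alpha>) * s powr growth = t powr (- \<alpha>)"
          using s t by (simp add: a_def powr_mult powr_powr growth_def mult.assoc powr_add[symmetric])
        ultimately show ?thesis by (simp add: rate_at_def algebra_simps)
      qed
      then have 3: "rate * s powr growth \<le> t * s / 2 + B * t powr (- \<alpha>)"
        using mult_right_mono[OF rate_le[OF a], of "s powr growth"] by simp
      have "area z * norm z powr s \<le> (K * exp (- B * t powr (- \<alpha>))) * exp (- (t * s / 2))"
      proof (rule mult_mono[OF _ 1])
        show "area z \<le> K * exp (- B * t powr (- \<alpha>))"
          using K(2)[OF z] mult_left_mono[OF 2, of K] K(1) by linarith
      qed (use K in auto)
      also have "\<dots> = K * exp (- (t * s / 2 + B * t powr (- \<alpha>)))"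
        by (simp add: mult.assoc exp_add[symmetric])
      also have "\<dots> \<le> K * exp (- rate * s powr growth)" using 3 K by (intro mult_left_mono) auto
      finally show ?thesis .
    qed
    have "moment s \<le> (\<integral>z. K * exp (- rate * s powr growth) \<partial>disc_measure)"
      unfolding moment_def
      by (rule integral_mono[OF area_powr_integrable]) (use s pt in \<open>auto simp: space_restrict_space\<close>)
    also have "\<dots> = (K * D) * exp (- rate * s powr growth)" by (simp add: D_def)
    also have "\<dots> \<le> (K * (D + 1)) * exp (- rate * s powr growth)"
      using K(1) by (intro mult_right_mono mult_left_mono) auto
    finally show ?thesis .
  qed
  moreover have "K * (D + 1) > 0" using K(1) by (simp add: D_def add_nonneg_pos)
  ultimately show ?thesis by blast
qed

text \<open>The integrand is estimated from below on the annulus \<open>\<tau> < 1 - \<bar>z\<bar>\<^sup>2 \<le> \<tau> + \<tau>\<^sup>2\<close>, of area \<open>\<pi> \<tau>\<^sup>2\<close>. Its relative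
  width \<open>\<tau>\<close> tends to zero, so nothing is lost in the leading term of the exponent.\<close>

lemma moment_lower:
  assumes \<tau>: "\<tau> > 0" "\<tau> + \<tau>\<^sup>2 < 1" and s: "s > 0"
  shows "pi * \<tau>\<^sup>2 * ((1 - \<tau> - \<tau>\<^sup>2) powr (s / 2) * (\<tau> powr A * exp (- B / \<tau> powr \<alpha>))) \<le> moment s"
proof -
  interpret D: finite_measure disc_measure by (rule finite_measure_disc)
  define r1 r2 where "r1 = sqrt (1 - \<tau> - \<tau>\<^sup>2)" and "r2 = sqrt (1 - \<tau>)"
  have t1: "\<tau> < 1" using \<tau> zero_le_power2[of \<tau>] by linarith
  have r: "0 < r1" "r1 \<le> r2" "r2 < 1" "r1\<^sup>2 = 1 - \<tau> - \<tau>\<^sup>2" "r2\<^sup>2 = 1 - \<tau>"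
    using \<tau> t1 by (auto simp: r1_def r2_def)
  define R where "R = ball (0::complex) r2 - ball 0 r1"
  have R_sub: "R \<subseteq> ball 0 1" using r by (auto simp: R_def)
  have R_sets: "R \<in> sets disc_measure"
    using R_sub by (simp add: sets_restrict_space_iff R_def)
  have R_meas: "measure disc_measure R = pi * \<tau>\<^sup>2"
  proof -
    have "measure disc_measure R = measure lborel R"
      using R_sub by (simp add: measure_restrict_space)
    also have "\<dots> = measure lborel (ball (0::complex) r2) - measure lborel (ball (0::complex) r1)"
      unfolding R_def using r emeasure_lborel_ball_finite[of "0::complex" r2] by (intro measure_Diff) (auto intro: subset_ball)
    also have "\<dots> = pi * r2\<^sup>2 - pi * r1\<^sup>2"
      using r by (simp add: content_ball unit_ball_vol_2)
    finally show ?thesis using r by (simp add: algebra_simps)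
  qed
  define c where "c = (1 - \<tau> - \<tau>\<^sup>2) powr (s / 2) * (\<tau> powr A * exp (- B / \<tau> powr \<alpha>))"
  have pt: "indicator R z * c \<le> area z * norm z powr s" if z: "z \<in> ball 0 1" for z
  proof (cases "z \<in> R")
    case True
    define t where "t = 1 - (norm z)\<^sup>2"
    have "norm z < r2" "r1 \<le> norm z" using True by (auto simp: R_def)
    then have "(norm z)\<^sup>2 < r2\<^sup>2" "r1\<^sup>2 \<le> (norm z)\<^sup>2"
      using power_strict_mono[of "norm z" r2 2] power_mono[of r1 "norm z" 2] r(1) by simp_all
    then have t: "\<tau> < t" "1 - \<tau> - \<tau>\<^sup>2 \<le> (norm z)\<^sup>2" using r by (auto simp: t_def)
    have "(1 - \<tau> - \<tau>\<^sup>2) powr (s / 2) \<le> ((norm z)\<^sup>2) powr (s / 2)"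
      using t \<tau> s by (intro powr_mono2) auto
    also have "\<dots> = norm z powr s"
      by (cases "z = 0") (simp_all add: powr_powr flip: powr_numeral)
    finally have 1: "(1 - \<tau> - \<tau>\<^sup>2) powr (s / 2) \<le> norm z powr s" .
    have "- B / \<tau> powr \<alpha> \<le> - B / t powr \<alpha>"
      using B \<alpha> \<tau> t by (simp add: divide_left_mono powr_mono2)
    then have "\<tau> powr A * exp (- B / \<tau> powr \<alpha>) \<le> t powr A * exp (- B / t powr \<alpha>)"
      using A \<tau> t by (intro mult_mono powr_mono2) auto
    also have "\<dots> \<le> area z" using profile_le_area[OF z] by (simp add: exp_profile_def t_def)
    finally have "c \<le> norm z powr s * area z" unfolding c_def by (intro mult_mono 1) auto
    then show ?thesis using True by (simp add: mult.commute)
  next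
    case False
    then show ?thesis using less_imp_le[OF area_pos[OF z]] by simp
  qed
  have "pi * \<tau>\<^sup>2 * c = (\<integral>z. indicator R z * c \<partial>disc_measure)"
    using R_sets by (simp add: R_meas[symmetric] Int_absorb2[OF R_sub])
  also have "\<dots> \<le> moment s"
    unfolding moment_def
    by (rule integral_mono[OF _ area_powr_integrable])
       (use s pt R_sets in \<open>auto simp: space_restrict_space less_top[symmetric]\<close>)
  finally show ?thesis by (simp add: c_def)
qed

text \<open>The logarithm of the lower bound, at \<open>s = (a / \<tau>) powr (1 + \<alpha>)\<close> and divided by \<open>s powr growth\<close>, which is
  \<open>(a / \<tau>) powr \<alpha>\<close>.\<close>

lemma lower_exponent_limit:
  fixes a :: real
  assumes a: "a > 0"
  shows "((\<lambda>\<tau>. (\<tau> / a) powr \<alpha> * (ln pi + (2 + A) * ln \<tau> + (a / \<tau>) powr (1 + \<alpha>) / 2 * ln (1 - \<tau> - \<tau>\<^sup>2)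
      - B / \<tau> powr \<alpha>)) \<longlongrightarrow> - rate_at a) (at_right 0)"
proof -
  have 1: "((\<lambda>\<tau>. (\<tau> / a) powr \<alpha> * ln pi) \<longlongrightarrow> 0) (at_right 0)"
    using a \<alpha> by real_asymp
  have 2: "((\<lambda>\<tau>. (\<tau> / a) powr \<alpha> * ((2 + A) * ln \<tau>)) \<longlongrightarrow> 0) (at_right 0)"
    using a \<alpha> A by real_asymp
  have 3: "((\<lambda>\<tau>. a / 2 * (ln (1 - \<tau> - \<tau>\<^sup>2) / \<tau>) - B * a powr (- \<alpha>)) \<longlongrightarrow> a / 2 * (-1) - B * a powr (- \<alpha>)) (at_right 0)"
    by (intro tendsto_intros) real_asymp
  have "((\<lambda>\<tau>. (\<tau> / a) powr \<alpha> * ln pi + (\<tau> / a) powr \<alpha> * ((2 + A) * ln \<tau>)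
      + (a / 2 * (ln (1 - \<tau> - \<tau>\<^sup>2) / \<tau>) - B * a powr (- \<alpha>))) \<longlongrightarrow> - rate_at a) (at_right 0)"
    using tendsto_add[OF tendsto_add[OF 1 2] 3] by (simp add: rate_at_def)
  then show ?thesis
  proof (rule Lim_transform_eventually)
    show "\<forall>\<^sub>F \<tau> in at_right 0. (\<tau> / a) powr \<alpha> * ln pi + (\<tau> / a) powr \<alpha> * ((2 + A) * ln \<tau>)
      + (a / 2 * (ln (1 - \<tau> - \<tau>\<^sup>2) / \<tau>) - B * a powr (- \<alpha>))
      = (\<tau> / a) powr \<alpha> * (ln pi + (2 + A) * ln \<tau> + (a / \<tau>) powr (1 + \<alpha>) / 2 * ln (1 - \<tau> - \<tau>\<^sup>2)
      - B / \<tau> powr \<alpha>)"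
      unfolding eventually_at_right_field
    proof (intro exI[of _ 1] conjI allI impI)
      fix \<tau> :: real assume t: "0 < \<tau>" "\<tau> < 1"
      have e1: "(\<tau> / a) powr \<alpha> * (a / \<tau>) powr (1 + \<alpha>) = a / \<tau>"
        using a t by (simp add: powr_divide powr_add field_simps)
      have e2: "(\<tau> / a) powr \<alpha> * (B / \<tau> powr \<alpha>) = B * a powr (- \<alpha>)"
        using a t by (simp add: powr_divide powr_minus field_simps)
      have "(\<tau> / a) powr \<alpha> * ((a / \<tau>) powr (1 + \<alpha>) / 2 * ln (1 - \<tau> - \<tau>\<^sup>2))
          = ((\<tau> / a) powr \<alpha> * (a / \<tau>) powr (1 + \<alpha>)) / 2 * ln (1 - \<tau> - \<tau>\<^sup>2)" by simp
      also have "\<dots> = a / 2 * (ln (1 - \<tau> - \<tau>\<^sup>2) / \<tau>)" unfolding e1 by simp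
      finally show "(\<tau> / a) powr \<alpha> * ln pi + (\<tau> / a) powr \<alpha> * ((2 + A) * ln \<tau>)
          + (a / 2 * (ln (1 - \<tau> - \<tau>\<^sup>2) / \<tau>) - B * a powr (- \<alpha>))
          = (\<tau> / a) powr \<alpha> * (ln pi + (2 + A) * ln \<tau> + (a / \<tau>) powr (1 + \<alpha>) / 2 * ln (1 - \<tau> - \<tau>\<^sup>2)
          - B / \<tau> powr \<alpha>)"
        unfolding right_diff_distrib distrib_left e2 by simp
    qed simp
  qed
qed

lemma moment_lower_asymp:
  fixes a :: real
  assumes a: "a > 0"
  obtains L where "(L \<longlongrightarrow> - rate_at a) at_top"
    and "eventually (\<lambda>s. L s * s powr growth \<le> ln (moment s)) at_top"
proof -
  define \<tau> where "\<tau> s = a * s powr (- (1 / (1 + \<alpha>)))" for s :: real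
  define G where "G \<tau> = (\<tau> / a) powr \<alpha> * (ln pi + (2 + A) * ln \<tau> + (a / \<tau>) powr (1 + \<alpha>) / 2 * ln (1 - \<tau> - \<tau>\<^sup>2)
      - B / \<tau> powr \<alpha>)" for \<tau>
  have pos: "\<tau> s > 0" if "s > 0" for s using a that by (simp add: \<tau>_def)
  have lim: "(\<tau> \<longlongrightarrow> 0) at_top"
    unfolding \<tau>_def using a \<alpha> by real_asymp
  have "filterlim \<tau> (at_right 0) at_top"
    by (rule tendsto_imp_filterlim_at_right[OF lim eventually_mono[OF eventually_gt_at_top[of 0] pos]])
  then have L: "((\<lambda>s. G (\<tau> s)) \<longlongrightarrow> - rate_at a) at_top"
    using lower_exponent_limit[OF a] unfolding G_def by (rule filterlim_compose[rotated])
  have "((\<lambda>s. \<tau> s + (\<tau> s)\<^sup>2) \<longlongrightarrow> 0 + 0\<^sup>2) at_top" by (intro tendsto_intros lim)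
  then have "eventually (\<lambda>s. \<tau> s + (\<tau> s)\<^sup>2 < 1) at_top" by (rule order_tendstoD) simp
  then have "eventually (\<lambda>s. G (\<tau> s) * s powr growth \<le> ln (moment s)) at_top"
    using eventually_gt_at_top[of 0]
  proof eventually_elim
    case (elim s)
    define t where "t = \<tau> s"
    have t: "t > 0" "t + t\<^sup>2 < 1" "1 - t - t\<^sup>2 > 0" using elim pos by (auto simp: t_def)
    have "a / t = s powr (1 / (1 + \<alpha>))"
      using a by (simp add: t_def \<tau>_def powr_minus_divide)
    then have s1: "(a / t) powr (1 + \<alpha>) = s"
      using elim \<alpha> by (simp add: powr_powr)
    have "t / a = s powr (- (1 / (1 + \<alpha>)))"
      using a by (simp add: t_def \<tau>_def)
    then have s2: "(t / a) powr \<alpha> * s powr growth = 1"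
      using elim by (simp add: powr_powr growth_def powr_add[symmetric])
    have "G t * s powr growth = ((t / a) powr \<alpha> * s powr growth) *
        (ln pi + (2 + A) * ln t + (a / t) powr (1 + \<alpha>) / 2 * ln (1 - t - t\<^sup>2) - B / t powr \<alpha>)"
      by (simp add: G_def mult_ac)
    also have "\<dots> = ln pi + (2 + A) * ln t + s / 2 * ln (1 - t - t\<^sup>2) - B / t powr \<alpha>"
      unfolding s1 s2 by simp
    also have "\<dots> = ln (pi * t\<^sup>2 * ((1 - t - t\<^sup>2) powr (s / 2) * (t powr A * exp (- B / t powr \<alpha>))))"
      using t by (simp add: ln_mult ln_powr ln_realpow algebra_simps)
    also have "\<dots> \<le> ln (moment s)"
      using t elim moment_lower[OF t(1,2), of s] by (intro ln_mono) auto
    finally show ?case by (simp add: t_def)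
  qed
  with L that show ?thesis by blast
qed

text \<open>Taking logarithms in the moment inequality and dividing by \<open>n powr growth\<close> compares
  \<open>p powr growth / p + q powr growth / q\<close>, called \<open>d\<close> below, with \<open>2 powr growth\<close>. Because \<open>p\<close> and \<open>q\<close> average to \<open>2\<close>
  with the weights \<open>1 / p\<close> and \<open>1 / q\<close>, strict concavity makes \<open>d\<close> smaller unless \<open>p = q\<close>.\<close>

theorem Szego_bounded_imp_2:
  assumes p: "p > 1" and bounded: "bounded_on_Lp p \<sigma> (Szego_projection \<Omega> \<sigma>)"
  shows "p = 2"
proof (rule ccontr)
  assume p2: "p \<noteq> 2"
  define q where "q = p / (p - 1)"
  have q: "q > 1" using p by (simp add: q_def field_simps)
  have pq: "1 / p + 1 / q = 1" "1 / p \<noteq> 1 / q" using p p2 by (auto simp: q_def field_simps)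
  obtain C where C: "C > 0" and ineq: "\<And>n. n \<ge> 1 \<Longrightarrow>
      moment (real n * p) powr (1 / p) * moment (real n * q) powr (1 / q) \<le> C * moment (2 * real n)"
    using Szego_bounded_imp_moment_inequality[OF p q_def bounded] by blast
  obtain K where K: "K > 0" and upper: "\<And>s. s > 0 \<Longrightarrow> moment s \<le> K * exp (- rate * s powr growth)"
    using moment_upper by blast
  define d where "d = (1 / p) powr (1 - growth) + (1 / q) powr (1 - growth)"
  have d: "d < 2 powr growth"
    using powr_sum_less[of "1 / p" "1 / q" "1 - growth"] p q pq growth_bounds by (simp add: d_def)
  have d0: "d > 0" using p q by (simp add: d_def add_pos_pos)
  \<comment> \<open>The upper bound is used for the moment of order \<open>2 n\<close>, the lower bound for those of order \<open>n p\<close> and \<open>n q\<close>.\<close>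
  have key: "rate * 2 powr growth \<le> d * rate_at a" if a: "a > 0" for a
  proof -
    obtain L where L: "(L \<longlongrightarrow> - rate_at a) at_top"
      and lower: "eventually (\<lambda>s. L s * s powr growth \<le> ln (moment s)) at_top"
      using moment_lower_asymp[OF a] by blast
    have at: "filterlim (\<lambda>n. real n * r) at_top sequentially" if "r > 1" for r :: real
      using that by real_asymp
    have ev: "eventually (\<lambda>n. L (real n * p) * ((1 / p) powr (1 - growth)) + L (real n * q) * ((1 / q) powr (1 - growth))
        \<le> (ln C + ln K) / real n powr growth - rate * 2 powr growth) sequentially"
      using eventually_compose_filterlim[OF lower at[OF p]] eventually_compose_filterlim[OF lower at[OF q]]
        eventually_ge_at_top[of 1]
    proof eventually_elim
      case (elim n)
      define N where "N = real n powr growth"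
      have N: "N > 0" using elim by (simp add: N_def)
      have m: "moment (real n * p) > 0" "moment (real n * q) > 0" "moment (2 * real n) > 0"
        using p q by (auto intro!: moment_pos)
      have "ln (moment (real n * p) powr (1 / p) * moment (real n * q) powr (1 / q)) \<le> ln (C * moment (2 * real n))"
        using ineq[OF elim(3)] m by (intro ln_mono) auto
      then have 1: "1 / p * ln (moment (real n * p)) + 1 / q * ln (moment (real n * q)) \<le> ln C + ln (moment (2 * real n))"
        using m C by (simp add: ln_mult ln_powr)
      have "ln (moment (2 * real n)) \<le> ln (K * exp (- rate * (2 * real n) powr growth))"
        using upper[of "2 * real n"] elim m by (intro ln_mono) auto
      also have "\<dots> = ln K - rate * 2 powr growth * N"
        using K by (simp add: ln_mult powr_mult N_def)
      finally have 2: "ln (moment (2 * real n)) \<le> ln K - rate * 2 powr growth * N" .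
      have scale: "L (real n * r) * ((1 / r) powr (1 - growth)) * N \<le> 1 / r * ln (moment (real n * r))"
        if r: "r > 1" and le: "L (real n * r) * (real n * r) powr growth \<le> ln (moment (real n * r))" for r
      proof -
        have "(1 / r) powr (1 - growth) = 1 / r * r powr growth"
          using r by (simp add: powr_divide powr_diff)
        then have "L (real n * r) * ((1 / r) powr (1 - growth)) * N = 1 / r * (L (real n * r) * (real n * r) powr growth)"
          using r by (simp add: powr_mult N_def)
        also have "\<dots> \<le> 1 / r * ln (moment (real n * r))" using r le by (intro mult_left_mono) auto
        finally show ?thesis .
      qed
      have "(L (real n * p) * ((1 / p) powr (1 - growth)) + L (real n * q) * ((1 / q) powr (1 - growth))) * N
          \<le> ln C + ln K - rate * 2 powr growth * N"
        using scale[OF p elim(1)] scale[OF q elim(2)] 1 2 by (simp add: distrib_right)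
      also have "\<dots> = ((ln C + ln K) / N - rate * 2 powr growth) * N" using N by (simp add: field_simps)
      finally show ?case using N by (simp add: N_def)
    qed
    have "(\<lambda>n. L (real n * p) * ((1 / p) powr (1 - growth)) + L (real n * q) * ((1 / q) powr (1 - growth)))
        \<longlonglongrightarrow> (- rate_at a) * ((1 / p) powr (1 - growth)) + (- rate_at a) * ((1 / q) powr (1 - growth))"
      by (intro tendsto_intros filterlim_compose[OF L] at p q)
    moreover have "(\<lambda>n. (ln C + ln K) / real n powr growth - rate * 2 powr growth) \<longlonglongrightarrow> 0 - rate * 2 powr growth"
      using growth_bounds(1) by (intro tendsto_intros) real_asymp
    ultimately have "(- rate_at a) * ((1 / p) powr (1 - growth)) + (- rate_at a) * ((1 / q) powr (1 - growth))
        \<le> 0 - rate * 2 powr growth"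
      using ev by (intro tendsto_le[OF sequentially_bot]) auto
    then show ?thesis by (simp add: d_def algebra_simps)
  qed
  have "rate * 2 powr growth / d \<le> rate"
    unfolding rate_def by (rule cINF_greatest) (use key d0 in \<open>auto simp: field_simps rate_def\<close>)
  then have "rate * 2 powr growth \<le> rate * d" using d0 by (simp add: field_simps)
  then show False using d rate_pos by simp
qed

end

theorem theorem2p1:
  fixes A B \<alpha> p :: real
    and \<phi> :: "complex \<Rightarrow> real"
    and \<Omega> :: "(complex \<times> complex) set"
  defines "\<phi> \<equiv> exp_profile A B \<alpha>"
    and "\<Omega> \<equiv> Hartogs_domain \<phi>"
  assumes "A \<ge> 0" and "B > 0" and "\<alpha> > 0" and "1 < p"
  shows "bounded_on_Lp p (surface_measure \<phi>) (Szego_projection \<Omega> (surface_measure \<phi>)) \<longleftrightarrow> p = 2"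
proof
  interpret exp_profile_domain A B \<alpha>
    by unfold_locales (fact assms)+
  show "p = 2" if "bounded_on_Lp p (surface_measure \<phi>) (Szego_projection \<Omega> (surface_measure \<phi>))"
    using Szego_bounded_imp_2[OF \<open>1 < p\<close>] that unfolding \<Omega>_def \<phi>_def by blast
  show "bounded_on_Lp p (surface_measure \<phi>) (Szego_projection \<Omega> (surface_measure \<phi>))" if "p = 2"
    unfolding that by (rule Szego_projection_bounded_L2)
qed

end
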